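(* Let $Z\subset\mathbb{S}_6$ be a finite nonempty set of points. Then $\alpha(Z)=\alpha(2Z)=\alpha(3Z)=1$ if and only if $Z=\{Q\}$ for a single point $Q$ satisfying one of: (a) $Q\in\widetilde{L_{ij}}\cap\widetilde{L_{kl}}\cap\widetilde{L_{mn}}$ for some pairwise distinct $i,j,k,l,m,n\in\{1,\dots,6\}$; (b) $Q\in E_i\cap\widetilde{L_{ij}}\cap\widetilde{C_j}$ for some distinct $i,j\in\{1,\dots,6\}$, where $C_j$ is the conic through the five points $\{P_1,\dots,P_6\}\setminus\{P_j\}$ and the line $L_{ij}$ is tangent to $C_j$ at $P_i$.
   Context: Let $P_1,\dots,P_6\in\mathbb{P}^2(\mathbb{C})$ be six general points and $f\colon\mathbb{S}_6\to\mathbb{P}^2$ the blow-up at them, with exceptional curves $E_i=f^{-1}(P_i)$; let $H$ be the pullback of the class of a line and $\mathbb{L}_6=3H-E_1-\dots-E_6=-K_{\mathbb{S}_6}$. For distinct $i,j$, $L_{ij}$ is the line through $P_i,P_j$; for a plane curve $C$, $\widetilde{C}$ denotes its proper transform in $\mathbb{S}_6$. For a finite set $Z\subset\mathbb{S}_6$ with ideal sheaf $\mathcal{I}_Z$ and a positive integer $m$, $\alpha(mZ)=\min\{d\ge 0:\ H^0(\mathbb{S}_6,d\mathbb{L}_6\otimes\mathcal{I}_Z^{(m)})\neq 0\}$, i.e. the least $d$ such that some effective divisor $D\in|d\mathbb{L}_6|$ has multiplicity at least $m$ at every point of $Z$. *)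

theory Defs
  imports "HOL-Computational_Algebra.Polynomial"
begin

text \<open>Homogeneous coordinates on the complex projective plane: vectors of C^3.\<close>
type_synonym vec3 = "complex \<times> complex \<times> complex"

definition vadd :: "vec3 \<Rightarrow> vec3 \<Rightarrow> vec3" where
  "vadd u v = (case u of (a,b,c) \<Rightarrow> case v of (x,y,z) \<Rightarrow> (a+x, b+y, c+z))"

definition smul :: "complex \<Rightarrow> vec3 \<Rightarrow> vec3" where
  "smul t v = (case v of (x,y,z) \<Rightarrow> (t*x, t*y, t*z))"

text \<open>Bilinear (not Hermitian) pairing: a linear form evaluated at a vector.\<close>
definition dotp :: "vec3 \<Rightarrow> vec3 \<Rightarrow> complex" where
  "dotp u v = (case u of (a,b,c) \<Rightarrow> case v of (x,y,z) \<Rightarrow> a*x + b*y + c*z)"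

definition det3 :: "vec3 \<Rightarrow> vec3 \<Rightarrow> vec3 \<Rightarrow> complex" where
  "det3 u v w = (case u of (a1,a2,a3) \<Rightarrow> case v of (b1,b2,b3) \<Rightarrow> case w of (c1,c2,c3) \<Rightarrow>
      a1*(b2*c3 - b3*c2) - a2*(b1*c3 - b3*c1) + a3*(b1*c2 - b2*c1))"

text \<open>Canonical representative of a point of P^2 (first nonzero coordinate equal to 1).\<close>
definition normalized :: "vec3 \<Rightarrow> bool" where
  "normalized v = (case v of (x,y,z) \<Rightarrow> x = 1 \<or> (x = 0 \<and> y = 1) \<or> (x = 0 \<and> y = 0 \<and> z = 1))"

definition hom_form :: "nat \<Rightarrow> (vec3 \<Rightarrow> complex) \<Rightarrow> bool" where
  "hom_form e F = (\<exists>c :: nat \<Rightarrow> nat \<Rightarrow> complex. \<forall>x y z.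
      F (x,y,z) = (\<Sum>a\<le>e. \<Sum>b\<le>e-a. c a b * x^a * y^b * z^(e-a-b)))"

text \<open>The form F has multiplicity at least m at the point [p] of P^2 (p nonzero):
  along every line through p the restriction vanishes to order at least m.\<close>
definition mult_ge :: "(vec3 \<Rightarrow> complex) \<Rightarrow> vec3 \<Rightarrow> nat \<Rightarrow> bool" where
  "mult_ge F p m = (\<forall>v. \<exists>q :: complex poly. \<forall>t. F (vadd p (smul t v)) = t^m * poly q t)"

definition general_position :: "(nat \<Rightarrow> vec3) \<Rightarrow> bool" where
  "general_position P =
     ((\<forall>i\<in>{1..6}. \<forall>j\<in>{1..6}. \<forall>k\<in>{1..6}. i \<noteq> j \<and> j \<noteq> k \<and> i \<noteq> k \<longrightarrow> det3 (P i) (P j) (P k) \<noteq> 0)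
      \<and> \<not> (\<exists>G. hom_form 2 G \<and> G \<noteq> (\<lambda>_. 0) \<and> (\<forall>i\<in>{1..6}. G (P i) = 0)))"

text \<open>Points of the blow-up S_6: either a point of P^2 other than the P_i (Ord p, p normalized),
  or a point of the exceptional curve E_i, i.e. a line through P_i, given by its normalized
  linear form l with l(P_i) = 0 (Exc i l).\<close>
datatype spt = Ord vec3 | Exc nat vec3

fun valid_pt :: "(nat \<Rightarrow> vec3) \<Rightarrow> spt \<Rightarrow> bool" where
  "valid_pt P (Ord p) = (normalized p \<and> (\<forall>i\<in>{1..6}. \<not> (\<exists>c. p = smul c (P i))))"
| "valid_pt P (Exc i l) = (i \<in> {1..6} \<and> normalized l \<and> dotp l (P i) = 0)"

definition section_dL :: "(nat \<Rightarrow> vec3) \<Rightarrow> nat \<Rightarrow> (vec3 \<Rightarrow> complex) \<Rightarrow> bool" where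
  "section_dL P d F = (hom_form (3*d) F \<and> (\<forall>i\<in>{1..6}. mult_ge F (P i) d))"

text \<open>The divisor D = f^*(F=0) - d(E_1+...+E_6) in |d L_6| has multiplicity at least m at Q.
  At a point of E_i we use the blow-up chart (x,y) |-> P_i + x R + x y W, in which
  the pullback of F equals x^d G(x,y) and D is given by G; the point Q is (0,0).\<close>
fun div_mult_ge :: "(nat \<Rightarrow> vec3) \<Rightarrow> nat \<Rightarrow> (vec3 \<Rightarrow> complex) \<Rightarrow> spt \<Rightarrow> nat \<Rightarrow> bool" where
  "div_mult_ge P d F (Ord p) m = mult_ge F p m"
| "div_mult_ge P d F (Exc i l) m =
     (\<forall>R W. dotp l R = 0 \<and> \<not> (\<exists>c. R = smul c (P i)) \<and> dotp l W \<noteq> 0 \<longrightarrow>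
        (\<forall>a b. a \<noteq> 0 \<longrightarrow> (\<exists>q :: complex poly. \<forall>s.
            F (vadd (P i) (vadd (smul (s*a) R) (smul (s*a*(s*b)) W))) = s^(d+m) * poly q s)))"

definition alpha :: "(nat \<Rightarrow> vec3) \<Rightarrow> spt set \<Rightarrow> nat \<Rightarrow> nat" where
  "alpha P Z m = (LEAST d. \<exists>F. section_dL P d F \<and> F \<noteq> (\<lambda>_. 0) \<and> (\<forall>Q\<in>Z. div_mult_ge P d F Q m))"

text \<open>Q lies on the proper transform of the plane curve {F = 0}. At a point of E_i
  (direction of the line l through P_i, R a point of that line other than P_i) this means
  the restriction of F to the line vanishes at P_i to order larger than mult_{P_i} F.\<close>
fun on_transform :: "(nat \<Rightarrow> vec3) \<Rightarrow> (vec3 \<Rightarrow> complex) \<Rightarrow> spt \<Rightarrow> bool" where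
  "on_transform P F (Ord p) = (F p = 0)"
| "on_transform P F (Exc i l) =
     (\<forall>R. dotp l R = 0 \<and> \<not> (\<exists>c. R = smul c (P i)) \<longrightarrow>
        (\<forall>m. mult_ge F (P i) m \<longrightarrow> (\<exists>q :: complex poly. \<forall>t. F (vadd (P i) (smul t R)) = t^(Suc m) * poly q t)))"

fun on_E :: "nat \<Rightarrow> spt \<Rightarrow> bool" where
  "on_E i (Ord p) = False"
| "on_E i (Exc k l) = (k = i)"

definition line_form :: "(nat \<Rightarrow> vec3) \<Rightarrow> nat \<Rightarrow> nat \<Rightarrow> vec3 \<Rightarrow> complex" where
  "line_form P i j = (\<lambda>x. det3 (P i) (P j) x)"

definition conic_eq :: "(nat \<Rightarrow> vec3) \<Rightarrow> nat \<Rightarrow> (vec3 \<Rightarrow> complex) \<Rightarrow> bool" where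
  "conic_eq P j G = (hom_form 2 G \<and> G \<noteq> (\<lambda>_. 0) \<and> (\<forall>k\<in>{1..6} - {j}. G (P k) = 0))"

definition cond_a :: "(nat \<Rightarrow> vec3) \<Rightarrow> spt \<Rightarrow> bool" where
  "cond_a P Q = (\<exists>i j k l m n. {i,j,k,l,m,n} \<subseteq> {1..6} \<and> card {i,j,k,l,m,n} = 6 \<and>
      on_transform P (line_form P i j) Q \<and> on_transform P (line_form P k l) Q \<and>
      on_transform P (line_form P m n) Q)"

text \<open>Condition (b); the last conjunct says L_ij is tangent to C_j at P_i.\<close>
definition cond_b :: "(nat \<Rightarrow> vec3) \<Rightarrow> spt \<Rightarrow> bool" where
  "cond_b P Q = (\<exists>i j. i \<in> {1..6} \<and> j \<in> {1..6} \<and> i \<noteq> j \<and>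
      (\<exists>G. conic_eq P j G \<and> on_E i Q \<and> on_transform P (line_form P i j) Q \<and> on_transform P G Q \<and>
           (\<exists>q :: complex poly. \<forall>t. G (vadd (P i) (smul t (P j))) = t^2 * poly q t)))"

end

theory Submission
  imports Defs
begin

text \<open>
  Since a section of degree 0 is constant, the left-hand side says that some nonzero cubic \<open>F\<close> through
  the six points is triple at every \<open>Q \<in> Z\<close>.  A triple point at an ordinary point \<open>p\<close> makes \<open>F\<close> a
  binary cubic on the pencil of lines through \<open>p\<close>; each such line contains at most two of the \<open>P i\<close>
  and \<open>F\<close> has at most three roots, so the six points are matched in pairs by three lines through \<open>p\<close>.
  A triple point in the direction \<open>R\<close> on \<open>E\<^sub>i\<close> means, in coordinates \<open>z, r, w\<close> for a basis \<open>P i, R, W\<close>,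
  that \<open>F = w (c z w + q(r, w))\<close>: a line times a conic tangent to it at \<open>P i\<close>.  The line contains
  at most one further \<open>P j\<close>, and not all six points lie on the conic, which is case (b).  Two triple
  points on different exceptional curves make \<open>F\<close> double at two of the \<open>P i\<close>; then the line joining
  them splits off and the residual conic contains all six points.  The other pairs of distinct triple points
  give a binary cubic with too many roots.
\<close>

subsection \<open>Forms and their multiplicities\<close>

text \<open>The letters keep their meaning throughout: \<open>z\<close> belongs to the point under
  study, \<open>r\<close> to a direction at that point, \<open>w\<close> to a third vector
  completing the frame.\<close>

definition lin3 :: "vec3 \<Rightarrow> vec3 \<Rightarrow> vec3 \<Rightarrow> complex \<Rightarrow> complex \<Rightarrow> complex \<Rightarrow> vec3" where
  "lin3 A B C z r w = vadd (smul z A) (vadd (smul r B) (smul w C))"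

lemmas vec_defs = vadd_def smul_def dotp_def det3_def lin3_def

lemma hom_form_zero: "hom_form e (\<lambda>_. 0)"
  unfolding hom_form_def by (intro exI[of _ "\<lambda>_ _. 0"]) simp

lemma hom_form_monomial:
  assumes "a + b + c = e"
  shows "hom_form e (\<lambda>(x,y,z). x^a * y^b * z^c)"
proof -
  have "x^a * y^b * z^c =
      (\<Sum>i\<le>e. \<Sum>j\<le>e-i. (if i = a then if j = b then 1 else 0 else 0) * x^i * y^j * z^(e-i-j))"
    for x y z :: complex
  proof -
    have inner: "(\<Sum>j\<le>e-i. (if i = a then if j = b then 1 else 0 else 0) * x^i * y^j * z^(e-i-j))
        = (if i = a then x^a * y^b * z^c else 0)" for i
    proof (cases "i = a")
      case True
      have "(\<Sum>j\<le>e-i. (if i = a then if j = b then 1 else 0 else 0) * x^i * y^j * z^(e-i-j))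
          = (\<Sum>j\<le>e-i. if b = j then x^i * y^j * z^(e-i-j) else 0)"
        using True by (intro sum.cong) auto
      then show ?thesis using True assms by (simp add: sum.delta) auto
    qed simp
    have "(\<Sum>i\<le>e. \<Sum>j\<le>e-i. (if i = a then if j = b then 1 else 0 else 0) * x^i * y^j * z^(e-i-j))
        = x^a * y^b * z^c"
      unfolding inner using assms by simp
    then show ?thesis by simp
  qed
  then show ?thesis unfolding hom_form_def by (intro exI) auto
qed

lemma hom_form_add:
  assumes "hom_form e F" "hom_form e G"
  shows "hom_form e (\<lambda>v. F v + G v)"
proof -
  obtain c where c: "\<And>x y z. F (x,y,z) = (\<Sum>a\<le>e. \<Sum>b\<le>e-a. c a b * x^a * y^b * z^(e-a-b))"
    using assms(1) unfolding hom_form_def by auto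
  obtain d where d: "\<And>x y z. G (x,y,z) = (\<Sum>a\<le>e. \<Sum>b\<le>e-a. d a b * x^a * y^b * z^(e-a-b))"
    using assms(2) unfolding hom_form_def by auto
  show ?thesis unfolding hom_form_def c d
    by (intro exI[of _ "\<lambda>a b. c a b + d a b"]) (simp add: sum.distrib algebra_simps)
qed

lemma hom_form_cmult:
  assumes "hom_form e F"
  shows "hom_form e (\<lambda>v. k * F v)"
proof -
  obtain c where c: "\<And>x y z. F (x,y,z) = (\<Sum>a\<le>e. \<Sum>b\<le>e-a. c a b * x^a * y^b * z^(e-a-b))"
    using assms(1) unfolding hom_form_def by auto
  show ?thesis unfolding hom_form_def c
    by (intro exI[of _ "\<lambda>a b. k * c a b"]) (simp add: sum_distrib_left algebra_simps)
qed

lemma hom_form_sum: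
  assumes "finite I" "\<And>i. i \<in> I \<Longrightarrow> hom_form e (F i)"
  shows "hom_form e (\<lambda>v. \<Sum>i\<in>I. F i v)"
  using assms by (induction I rule: finite_induct) (auto simp: hom_form_zero intro!: hom_form_add)

text \<open>An equation of functions, rather than of values at triples, lets
  \<open>hom_form_sum\<close> reduce closure properties to single monomials.\<close>

lemma hom_form_expand:
  assumes "hom_form e F"
  obtains c where "F = (\<lambda>v. \<Sum>a\<le>e. \<Sum>b\<le>e-a. c a b * (case v of (x,y,z) \<Rightarrow> x^a * y^b * z^(e-a-b)))"
proof -
  obtain c where c: "\<And>x y z. F (x,y,z) = (\<Sum>a\<le>e. \<Sum>b\<le>e-a. c a b * x^a * y^b * z^(e-a-b))"
    using assms unfolding hom_form_def by auto
  show ?thesis by (rule that[of c]) (auto simp: fun_eq_iff c mult.assoc)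
qed

lemma hom_form_mult:
  assumes "hom_form d F" "hom_form e G"
  shows "hom_form (d + e) (\<lambda>v. F v * G v)"
proof -
  obtain f where f: "F = (\<lambda>v. \<Sum>a\<le>d. \<Sum>b\<le>d-a. f a b * (case v of (x,y,z) \<Rightarrow> x^a * y^b * z^(d-a-b)))"
    by (rule hom_form_expand[OF assms(1)])
  obtain g where g: "G = (\<lambda>v. \<Sum>a\<le>e. \<Sum>b\<le>e-a. g a b * (case v of (x,y,z) \<Rightarrow> x^a * y^b * z^(e-a-b)))"
    by (rule hom_form_expand[OF assms(2)])
  have mono: "hom_form (d + e) (\<lambda>v. (h * (case v of (x,y,z) \<Rightarrow> x^a * y^b * z^(d-a-b))) *
      (k * (case v of (x,y,z) \<Rightarrow> x^a' * y^b' * z^(e-a'-b'))))"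
    if "a \<le> d" "b \<le> d - a" "a' \<le> e" "b' \<le> e - a'" for a b a' b' h k
  proof -
    have "hom_form (d + e) (\<lambda>(x,y,z). x^(a+a') * y^(b+b') * z^((d-a-b)+(e-a'-b')))"
      using that by (intro hom_form_monomial) simp
    from hom_form_cmult[OF this, of "h * k"] show ?thesis
      by (rule back_subst[of "hom_form (d + e)"])
        (simp add: fun_eq_iff power_add split_beta mult_ac del: diff_diff_left)
  qed
  have G_mono: "hom_form (d + e) (\<lambda>v. (h * (case v of (x,y,z) \<Rightarrow> x^a * y^b * z^(d-a-b))) * G v)"
    if "a \<le> d" "b \<le> d - a" for a b h
  proof -
    have "hom_form (d + e) (\<lambda>v. \<Sum>a'\<le>e. \<Sum>b'\<le>e-a'. (h * (case v of (x,y,z) \<Rightarrow> x^a * y^b * z^(d-a-b))) *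
      (g a' b' * (case v of (x,y,z) \<Rightarrow> x^a' * y^b' * z^(e-a'-b'))))"
      by (rule hom_form_sum, simp)+ (rule mono, use that in auto)
    then show ?thesis unfolding g sum_distrib_left .
  qed
  have "hom_form (d + e) (\<lambda>v. \<Sum>a\<le>d. \<Sum>b\<le>d-a.
      f a b * (case v of (x,y,z) \<Rightarrow> x^a * y^b * z^(d-a-b)) * G v)"
    by (rule hom_form_sum, simp)+ (rule G_mono, auto)
  then show ?thesis unfolding f sum_distrib_right .
qed

lemma hom_form_1: "hom_form 0 (\<lambda>_. 1)"
  using hom_form_monomial[of 0 0 0 0] by (simp add: case_prod_unfold)

lemma hom_form_power:
  assumes "hom_form d F"
  shows "hom_form (n * d) (\<lambda>v. F v ^ n)"
proof (induction n)
  case 0 then show ?case by (simp add: hom_form_1)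
next
  case (Suc n) then show ?case using hom_form_mult[OF assms Suc] by simp
qed

lemma hom_form_linear: "hom_form 1 (\<lambda>(x,y,z). a * x + b * y + c * z)"
proof -
  have "hom_form 1 (\<lambda>v. a * (case v of (x,y,z) \<Rightarrow> x^1 * y^0 * z^0) +
     (b * (case v of (x,y,z) \<Rightarrow> x^0 * y^1 * z^0) + c * (case v of (x,y,z) \<Rightarrow> x^0 * y^0 * z^1)))"
    by (intro hom_form_add hom_form_cmult hom_form_monomial) auto
  then show ?thesis by (simp add: case_prod_unfold add.assoc)
qed

text \<open>Each monomial of degree \<open>e\<close> in \<open>X\<close>, \<open>Y\<close>,
  \<open>Z\<close> is a product of \<open>e\<close> forms of degree \<open>d\<close>. With linear
  forms substituted, this is the change of coordinates behind \<open>hom_form_lin3\<close> and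
  \<open>quadric_in_coords\<close>.\<close>

lemma hom_form_compose:
  assumes F: "hom_form e F" and "hom_form d X" "hom_form d Y" "hom_form d Z"
  shows "hom_form (e * d) (\<lambda>v. F (X v, Y v, Z v))"
proof -
  obtain f where f: "F = (\<lambda>v. \<Sum>a\<le>e. \<Sum>b\<le>e-a. f a b * (case v of (x,y,z) \<Rightarrow> x^a * y^b * z^(e-a-b)))"
    by (rule hom_form_expand[OF F])
  have mono: "hom_form (e * d) (\<lambda>v. f a b * (X v ^ a * Y v ^ b * Z v ^ (e-a-b)))"
    if "a \<le> e" "b \<le> e - a" for a b
  proof -
    have "hom_form (a * d + b * d + (e-a-b) * d) (\<lambda>v. X v ^ a * Y v ^ b * Z v ^ (e-a-b))"
      using assms by (intro hom_form_mult hom_form_power)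
    moreover have "a * d + b * d + (e-a-b) * d = e * d"
      using that by (simp flip: add_mult_distrib)
    ultimately show ?thesis by (auto intro: hom_form_cmult)
  qed
  show ?thesis unfolding f prod.case by (rule hom_form_sum, simp)+ (rule mono, auto)
qed

lemma hom_form_lin3:
  assumes "hom_form e F"
  shows "hom_form e (\<lambda>(z,r,w). F (lin3 A B C z r w))"
proof -
  obtain a1 a2 a3 b1 b2 b3 c1 c2 c3 where eq: "A = (a1,a2,a3)" "B = (b1,b2,b3)" "C = (c1,c2,c3)"
    by (metis prod_cases3)
  have "hom_form (e * 1) (\<lambda>v. F ((case v of (x,y,z) \<Rightarrow> a1 * x + b1 * y + c1 * z),
     (case v of (x,y,z) \<Rightarrow> a2 * x + b2 * y + c2 * z), (case v of (x,y,z) \<Rightarrow> a3 * x + b3 * y + c3 * z)))"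
    by (intro hom_form_compose assms hom_form_linear)
  then show ?thesis unfolding eq mult_1_right
    by (rule back_subst[of "hom_form e"]) (auto simp: fun_eq_iff vec_defs algebra_simps)
qed

lemma hom_form_det3: "hom_form 1 (\<lambda>v. det3 A B v)"
proof -
  obtain a1 a2 a3 b1 b2 b3 where eq: "A = (a1,a2,a3)" "B = (b1,b2,b3)"
    by (metis prod_cases3)
  show ?thesis using hom_form_linear[of "a2*b3-a3*b2" "a3*b1-a1*b3" "a1*b2-a2*b1"]
    unfolding eq by (rule back_subst[of "hom_form 1"]) (auto simp: fun_eq_iff vec_defs algebra_simps)
qed

text \<open>The digits of a coefficient name are the exponents of \<open>z\<close>,
  \<open>r\<close>, \<open>w\<close>; the coefficient function of \<open>hom_form\<close> records
  only the first two.\<close>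

lemma cubic_expand:
  assumes "hom_form 3 F"
  obtains c300 c210 c201 c120 c111 c102 c030 c021 c012 c003 where
    "\<And>z r w. F (lin3 A B C z r w) = c300 * z^3 + c210 * z^2 * r + c201 * z^2 * w +
      c120 * z * r^2 + c111 * z * r * w + c102 * z * w^2 +
      c030 * r^3 + c021 * r^2 * w + c012 * r * w^2 + c003 * w^3"
proof -
  obtain c where c: "\<And>z r w. F (lin3 A B C z r w) =
      (\<Sum>a\<le>3. \<Sum>b\<le>3-a. c a b * z^a * r^b * w^(3-a-b))"
    using hom_form_lin3[OF assms, of A B C] unfolding hom_form_def by auto
  show ?thesis
    by (rule that[of "c 3 0" "c 2 1" "c 2 0" "c 1 2" "c 1 1" "c 1 0" "c 0 3" "c 0 2" "c 0 1" "c 0 0"])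
       (simp add: c numeral_2_eq_2 numeral_3_eq_3 del: power_Suc)
qed

lemma quadric_expand:
  assumes "hom_form 2 F"
  obtains c200 c110 c101 c020 c011 c002 where
    "\<And>z r w. F (lin3 A B C z r w) = c200 * z^2 + c110 * z * r + c101 * z * w +
      c020 * r^2 + c011 * r * w + c002 * w^2"
proof -
  obtain c where c: "\<And>z r w. F (lin3 A B C z r w) =
      (\<Sum>a\<le>2. \<Sum>b\<le>2-a. c a b * z^a * r^b * w^(2-a-b))"
    using hom_form_lin3[OF assms, of A B C] unfolding hom_form_def by auto
  show ?thesis
    by (rule that[of "c 2 0" "c 1 1" "c 1 0" "c 0 2" "c 0 1" "c 0 0"])
       (simp add: c numeral_2_eq_2 numeral_3_eq_3 del: power_Suc)
qed

section \<open>Restriction of forms to lines and arcs\<close>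

lemma hom_form_along_poly:
  assumes "hom_form e F"
  obtains q where "\<And>s. F (poly X s, poly Y s, poly Z s) = poly q s"
proof -
  obtain c where c: "\<And>x y z. F (x,y,z) = (\<Sum>a\<le>e. \<Sum>b\<le>e-a. c a b * x^a * y^b * z^(e-a-b))"
    using assms unfolding hom_form_def by auto
  show ?thesis
    by (rule that[of "\<Sum>a\<le>e. \<Sum>b\<le>e-a. smult (c a b) (X^a * Y^b * Z^(e-a-b))"])
       (simp add: c poly_sum mult.assoc)
qed

text \<open>The arc is the image of the line \<open>x = s*a\<close>, \<open>y = s*b\<close> under
  the blow-up chart at \<open>p\<close>, so multiplicity on an exceptional curve is tested along
  such arcs.\<close>

lemma hom_form_along_arc:
  assumes "hom_form e F"
  obtains q where "\<And>s. F (vadd p (vadd (smul (s*a) R) (smul (s*a*(s*b)) W))) = poly q s"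
proof -
  obtain p1 p2 p3 r1 r2 r3 w1 w2 w3 where eq: "p = (p1,p2,p3)" "R = (r1,r2,r3)" "W = (w1,w2,w3)"
    by (metis prod_cases3)
  obtain q where q: "\<And>s. F (poly [:p1, a*r1, a*b*w1:] s, poly [:p2, a*r2, a*b*w2:] s,
      poly [:p3, a*r3, a*b*w3:] s) = poly q s"
    using hom_form_along_poly[OF assms] by metis
  show ?thesis
    by (rule that[of q]) (use q in \<open>simp add: eq vec_defs algebra_simps\<close>)
qed

lemma vadd_0 [simp]: "vadd p (0,0,0) = p" "vadd (0,0,0) p = p" "smul 0 p = (0,0,0)" "smul 1 p = p"
  by (cases p; simp add: vec_defs)+

text \<open>A line is the arc with \<open>a = 1\<close> and \<open>b = 0\<close>, for which the
  quadratic term disappears.\<close>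

lemma hom_form_along_line:
  assumes "hom_form e F"
  obtains q where "\<And>t. F (vadd p (smul t v)) = poly q t"
  using hom_form_along_arc[OF assms, of p 1 v 0] by auto

lemma poly_vanish_at_0:
  fixes q :: "complex poly"
  assumes "poly q 0 = 0"
  obtains q' where "\<And>s. poly q s = s * poly q' s"
  using assms by (cases q) (auto intro: that)

lemma arc_vanish:
  assumes "hom_form e F" "F p = 0"
  shows "\<exists>q. \<forall>s. F (vadd p (vadd (smul (s*a) R) (smul (s*a*(s*b)) W))) = s * poly q s"
proof -
  obtain q where q: "\<And>s. F (vadd p (vadd (smul (s*a) R) (smul (s*a*(s*b)) W))) = poly q s"
    using hom_form_along_arc[OF assms(1)] by metis
  have "poly q 0 = 0" using q[of 0] assms(2) by simp
  with poly_vanish_at_0[OF this] q show ?thesis by metis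
qed

lemma mult_ge_1:
  assumes "hom_form e F" "F p = 0"
  shows "mult_ge F p 1"
  using arc_vanish[OF assms, of 1 _ 0] by (auto simp: mult_ge_def)

lemma mult_ge_mult:
  assumes "mult_ge F p m" "mult_ge G p n"
  shows "mult_ge (\<lambda>v. F v * G v) p (m + n)"
  unfolding mult_ge_def
proof
  fix v
  obtain q q' where "\<And>t. F (vadd p (smul t v)) = t^m * poly q t" "\<And>t. G (vadd p (smul t v)) = t^n * poly q' t"
    using assms unfolding mult_ge_def by metis
  then have "\<forall>t. F (vadd p (smul t v)) * G (vadd p (smul t v)) = t^(m+n) * poly (q * q') t"
    by (simp add: power_add)
  then show "\<exists>q. \<forall>t. F (vadd p (smul t v)) * G (vadd p (smul t v)) = t^(m+n) * poly q t" by blast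
qed

lemma mult_ge_mono:
  assumes "mult_ge F p m" "n \<le> m"
  shows "mult_ge F p n"
  unfolding mult_ge_def
proof
  fix v
  obtain q where "\<And>t. F (vadd p (smul t v)) = t^m * poly q t"
    using assms unfolding mult_ge_def by metis
  then have "\<forall>t. F (vadd p (smul t v)) = t^n * poly (monom 1 (m-n) * q) t"
    using assms(2) by (simp add: poly_monom flip: power_add mult.assoc)
  then show "\<exists>q. \<forall>t. F (vadd p (smul t v)) = t^n * poly q t" by blast
qed

lemma mult_ge_vanish:
  assumes "mult_ge F p m" "m \<noteq> 0"
  shows "F p = 0"
proof -
  obtain q where "\<And>t. F (vadd p (smul t p)) = t^m * poly q t"
    using assms unfolding mult_ge_def by metis
  from this[of 0] show ?thesis using assms(2) by simp
qed

text \<open>On the line joining a point where \<open>F\<close> is nonzero to one where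
  \<open>G\<close> is nonzero, both forms restrict to nonzero polynomials, and polynomials have no
  zero divisors.\<close>

lemma hom_form_mult_nonzero:
  assumes "hom_form d F" "hom_form e G" "F \<noteq> (\<lambda>_. 0)" "G \<noteq> (\<lambda>_. 0)"
  shows "(\<lambda>v. F v * G v) \<noteq> (\<lambda>_. 0)"
proof
  assume *: "(\<lambda>v. F v * G v) = (\<lambda>_. 0)"
  obtain u v where uv: "F u \<noteq> 0" "G v \<noteq> 0" using assms(3,4) by (auto simp: fun_eq_iff)
  define d where "d = vadd v (smul (-1) u)"
  have d: "vadd u (smul 1 d) = v" unfolding d_def by (cases u; cases v) (auto simp: vec_defs)
  obtain f where f: "\<And>t. F (vadd u (smul t d)) = poly f t" using hom_form_along_line[OF assms(1)] by metis
  obtain g where g: "\<And>t. G (vadd u (smul t d)) = poly g t" using hom_form_along_line[OF assms(2)] by metis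
  have "poly (f * g) t = 0" for t using fun_cong[OF *, of "vadd u (smul t d)"] f g by simp
  then have "f * g = 0" using poly_all_0_iff_0 by blast
  then have "f = 0 \<or> g = 0" by simp
  then show False using uv f[of 0] g[of 1] d by auto
qed

text \<open>Turns the pointwise divisibility in the definitions of multiplicity into equations for
  coefficients; over an infinite field, polynomials with equal values are equal.\<close>

lemma poly_low_coeffs:
  fixes p q :: "complex poly"
  assumes "\<And>t. poly p t = t^m * poly q t" "k < m"
  shows "coeff p k = 0"
proof -
  have "poly p = poly (monom 1 m * q)" using assms(1) by (simp add: fun_eq_iff poly_monom)
  then have "p = monom 1 m * q" by (simp only: poly_eq_poly_eq_iff)
  then show ?thesis using assms(2) by (simp add: coeff_monom_mult)
qed

subsection \<open>Coordinates with respect to a basis\<close>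

lemma smul_smul: "smul a (smul b v) = smul (a * b) v"
  by (cases v; simp add: vec_defs)

lemma smul_lin3: "smul k (lin3 A B C z r w) = lin3 A B C (k * z) (k * r) (k * w)"
  by (cases A; cases B; cases C; simp add: vec_defs algebra_simps)

text \<open>Cramer's rule, first multiplied by the determinant so that it is a polynomial
  identity.\<close>

lemma lin3_coords:
  assumes "det3 A B C \<noteq> 0"
  obtains z r w where "v = lin3 A B C z r w"
proof -
  obtain a1 a2 a3 b1 b2 b3 c1 c2 c3 v1 v2 v3
    where eq: "A = (a1,a2,a3)" "B = (b1,b2,b3)" "C = (c1,c2,c3)" "v = (v1,v2,v3)"
    by (metis prod_cases3)
  let ?D = "det3 A B C"
  have "smul ?D v = lin3 A B C (det3 v B C) (det3 A v C) (det3 A B v)"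
    by (simp add: eq vec_defs algebra_simps)
  then have "smul (1 / ?D) (smul ?D v) = smul (1 / ?D) (lin3 A B C (det3 v B C) (det3 A v C) (det3 A B v))"
    by simp
  then have "v = lin3 A B C (1 / ?D * det3 v B C) (1 / ?D * det3 A v C) (1 / ?D * det3 A B v)"
    unfolding smul_lin3 smul_smul using assms by simp
  then show ?thesis by (rule that)
qed

lemma det3_lin3 [simp]:
  "det3 A B (lin3 A B C z r w) = w * det3 A B C"
  "det3 (lin3 A B C z r w) B C = z * det3 A B C"
  "det3 A (lin3 A B C z r w) C = r * det3 A B C"
  by (cases A; cases B; cases C; simp add: vec_defs algebra_simps)+

lemma det3_lin3_lin3 [simp]:
  "det3 A (lin3 A B C z r w) (lin3 A B C z' r' w') = (r * w' - r' * w) * det3 A B C"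
  by (cases A; cases B; cases C; simp add: vec_defs algebra_simps)

lemma det3_swap: "det3 A B C = - det3 B A C" "det3 A B C = - det3 A C B"
  by (cases A; cases B; cases C; simp add: vec_defs algebra_simps)+

lemma det3_cyclic: "det3 A B C = det3 B C A"
  using det3_swap by metis

lemma det3_lin3_right: "det3 u v (lin3 A B C z r w) = z * det3 u v A + r * det3 u v B + w * det3 u v C"
  by (cases A; cases B; cases C; cases u; cases v; simp add: vec_defs algebra_simps)

lemma det3_repeat [simp]: "det3 A A B = 0" "det3 A B A = 0" "det3 B A A = 0"
  by (cases A; cases B; simp add: vec_defs algebra_simps)+

lemma det3_zero [simp]: "det3 (0,0,0) B C = 0"  "det3 B (0,0,0) C = 0"  "det3 B C (0,0,0) = 0"
  by (cases B; cases C; simp add: vec_defs)+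

lemma lin3_axes [simp]:
  "lin3 A B C 1 0 0 = A" "lin3 A B C 0 1 0 = B" "lin3 A B C 0 0 1 = C"
  "lin3 A B C z 0 0 = smul z A"
  by (cases A; cases B; cases C; simp add: vec_defs)+

lemma lin3_swap: "lin3 A B C z r w = lin3 A C B z w r" "lin3 A B C z r w = lin3 B A C r z w"
  by (cases A; cases B; cases C; simp add: vec_defs algebra_simps)+

lemma line_lin3: "vadd A (smul t (lin3 A B C z r w)) = lin3 A B C (1 + t*z) (t*r) (t*w)"
  by (cases A; cases B; cases C; simp add: vec_defs algebra_simps)

lemma arc_lin3: "vadd A (vadd (smul r B) (smul w C)) = lin3 A B C 1 r w"
  by (cases A; simp add: vec_defs)

lemma div_mult_ge_lin3: "div_mult_ge P d F (Exc i l) m \<longleftrightarrow>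
    (\<forall>R W. dotp l R = 0 \<and> \<not> (\<exists>c. R = smul c (P i)) \<and> dotp l W \<noteq> 0 \<longrightarrow>
      (\<forall>a b. a \<noteq> 0 \<longrightarrow> (\<exists>q. \<forall>s. F (lin3 (P i) R W 1 (s*a) (s*a*(s*b))) = s^(d+m) * poly q s)))"
  by (simp only: div_mult_ge.simps arc_lin3)

lemma mult_ge_lin3:
  assumes "mult_ge F A m"
  obtains q where "\<And>t. F (lin3 A B C (1 + t*z) (t*r) (t*w)) = t^m * poly q t"
  using assms that unfolding mult_ge_def by (metis line_lin3)

section \<open>Normal forms at a double or triple point\<close>

text \<open>Multiplicity 2 at \<open>A\<close> bounds the degree in \<open>z\<close> by 1. The three
  offending coefficients are read off on the lines through \<open>A\<close> in the directions
  \<open>B\<close> and \<open>C\<close>.\<close>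

lemma cubic_double:
  assumes "hom_form 3 F" "mult_ge F A 2"
  obtains c120 c111 c102 c030 c021 c012 c003 where
    "\<And>z r w. F (lin3 A B C z r w) =
      c120 * z * r^2 + c111 * z * r * w + c102 * z * w^2 +
      c030 * r^3 + c021 * r^2 * w + c012 * r * w^2 + c003 * w^3"
proof -
  obtain c300 c210 c201 c120 c111 c102 c030 c021 c012 c003 where
    F: "\<And>z r w. F (lin3 A B C z r w) = c300 * z^3 + c210 * z^2 * r + c201 * z^2 * w +
      c120 * z * r^2 + c111 * z * r * w + c102 * z * w^2 +
      c030 * r^3 + c021 * r^2 * w + c012 * r * w^2 + c003 * w^3"
    using cubic_expand[OF assms(1), where A = A and B = B and C = C] by blast
  obtain q where q: "\<And>t. F (lin3 A B C (1 + t*0) (t*1) (t*0)) = t^2 * poly q t"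
    using mult_ge_lin3[OF assms(2)] by blast
  have "poly [:c300, c210, c120, c030:] t = t^2 * poly q t" for t
    using q[of t] by (simp add: F algebra_simps power2_eq_square power3_eq_cube)
  note c1 = poly_low_coeffs[OF this]
  obtain q where q: "\<And>t. F (lin3 A B C (1 + t*0) (t*0) (t*1)) = t^2 * poly q t"
    using mult_ge_lin3[OF assms(2)] by blast
  have "poly [:c300, c201, c102, c003:] t = t^2 * poly q t" for t
    using q[of t] by (simp add: F algebra_simps power2_eq_square power3_eq_cube)
  note c2 = poly_low_coeffs[OF this]
  have "c300 = 0" "c210 = 0" "c201 = 0" using c1[of 0] c1[of 1] c2[of 1] by auto
  with F that show ?thesis by auto
qed

text \<open>Multiplicity 3 removes \<open>z\<close> altogether: \<open>F\<close> is a cone with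
  vertex \<open>A\<close>, a binary cubic on the pencil of lines through \<open>A\<close>.\<close>

lemma cubic_triple:
  assumes "hom_form 3 F" "mult_ge F A 3"
  obtains c030 c021 c012 c003 where
    "\<And>z r w. F (lin3 A B C z r w) = c030 * r^3 + c021 * r^2 * w + c012 * r * w^2 + c003 * w^3"
proof -
  have m2: "mult_ge F A 2" by (rule mult_ge_mono[OF assms(2)]) simp
  obtain c120 c111 c102 c030 c021 c012 c003 where
    F: "\<And>z r w. F (lin3 A B C z r w) =
      c120 * z * r^2 + c111 * z * r * w + c102 * z * w^2 +
      c030 * r^3 + c021 * r^2 * w + c012 * r * w^2 + c003 * w^3"
    using cubic_double[OF assms(1) m2] by blast
  \<comment> \<open>The coefficient of \<open>z\<close> in \<open>F\<close> is a binary quadratic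
    form whose value at \<open>(r, w)\<close> is the coefficient of \<open>t^2\<close> along that
    direction. It vanishes in every direction, and three directions determine it.\<close>
  have *: "c120 * r^2 + c111 * r * w + c102 * w^2 = 0" for r w
  proof -
    obtain q where q: "\<And>t. F (lin3 A B C (1 + t*0) (t*r) (t*w)) = t^3 * poly q t"
      using mult_ge_lin3[OF assms(2)] by blast
    have "poly [:0, 0, c120 * r^2 + c111 * r * w + c102 * w^2,
        c030 * r^3 + c021 * r^2 * w + c012 * r * w^2 + c003 * w^3:] t = t^3 * poly q t" for t
      using q[of t] by (simp add: F algebra_simps power2_eq_square power3_eq_cube)
    from poly_low_coeffs[OF this, of 2] show ?thesis by (simp add: numeral_2_eq_2)
  qed
  have "c120 = 0" "c102 = 0" "c111 = 0" using *[of 1 0] *[of 0 1] *[of 1 1] by auto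
  with F that show ?thesis by auto
qed

lemma quadric_double:
  assumes "hom_form 2 F" "mult_ge F A 2"
  obtains c020 c011 c002 where
    "\<And>z r w. F (lin3 A B C z r w) = c020 * r^2 + c011 * r * w + c002 * w^2"
proof -
  obtain c200 c110 c101 c020 c011 c002 where
    F: "\<And>z r w. F (lin3 A B C z r w) = c200 * z^2 + c110 * z * r + c101 * z * w +
      c020 * r^2 + c011 * r * w + c002 * w^2"
    using quadric_expand[OF assms(1), where A = A and B = B and C = C] by blast
  obtain q where q: "\<And>t. F (lin3 A B C (1 + t*0) (t*1) (t*0)) = t^2 * poly q t"
    using mult_ge_lin3[OF assms(2)] by blast
  have "poly [:c200, c110, c020:] t = t^2 * poly q t" for t
    using q[of t] by (simp add: F algebra_simps power2_eq_square)
  note c1 = poly_low_coeffs[OF this]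
  obtain q where q: "\<And>t. F (lin3 A B C (1 + t*0) (t*0) (t*1)) = t^2 * poly q t"
    using mult_ge_lin3[OF assms(2)] by blast
  have "poly [:c200, c101, c002:] t = t^2 * poly q t" for t
    using q[of t] by (simp add: F algebra_simps power2_eq_square)
  note c2 = poly_low_coeffs[OF this]
  have "c200 = 0" "c110 = 0" "c101 = 0" using c1[of 0] c1[of 1] c2[of 1] by auto
  with F that show ?thesis by auto
qed

lemma form_zero_lin3:
  assumes "det3 A B C \<noteq> 0" "\<And>z r w. F (lin3 A B C z r w) = 0"
  shows "F = (\<lambda>_. 0)"
  using lin3_coords[OF assms(1)] assms(2) by (metis ext)

section \<open>Cones with too many roots\<close>

text \<open>The determinants say that the four lines from \<open>p\<close> to \<open>a\<close>,
  \<open>b\<close>, \<open>c\<close>, \<open>d\<close> are distinct, so they are four roots of a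
  binary cubic.\<close>

lemma cubic_cone_four_roots:
  assumes F: "hom_form 3 F" "mult_ge F p 3"
    and zeros: "F a = 0" "F b = 0" "F c = 0" "F d = 0"
    and dets: "det3 p a b \<noteq> 0" "det3 p a c \<noteq> 0" "det3 p a d \<noteq> 0"
      "det3 p b c \<noteq> 0" "det3 p b d \<noteq> 0" "det3 p c d \<noteq> 0"
  shows "F = (\<lambda>_. 0)"
proof -
  obtain c0 c1 c2 c3 where
    E: "\<And>z r w. F (lin3 p a b z r w) = c0 * r^3 + c1 * r^2 * w + c2 * r * w^2 + c3 * w^3"
    using cubic_triple[OF F, where B = a and C = b] by blast
  \<comment> \<open>The roots at \<open>a\<close> and \<open>b\<close> split off the factor
    \<open>r * w\<close>; the remaining linear form \<open>c1 * r + c2 * w\<close> vanishes at two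
    independent vectors coming from \<open>c\<close> and \<open>d\<close>.\<close>
  have c03: "c0 = 0" "c3 = 0" using E[of 0 1 0] E[of 0 0 1] zeros by auto
  obtain z r w where c: "c = lin3 p a b z r w" using lin3_coords[OF dets(1)] by blast
  obtain z' r' w' where d: "d = lin3 p a b z' r' w'" using lin3_coords[OF dets(1)] by blast
  have nz: "w \<noteq> 0" "w' \<noteq> 0" using dets(2,3) by (auto simp: c d)
  \<comment> \<open>The instance \<open>0 0 1\<close> rewrites \<open>b\<close> itself as a
    combination of \<open>p\<close>, \<open>a\<close>, \<open>b\<close>, so that the determinants
    with \<open>b\<close> expose \<open>r\<close> and \<open>r'\<close>.\<close>
  have nz': "r \<noteq> 0" "r' \<noteq> 0"
    using dets(4,5) det3_lin3_lin3[of p a b 0 0 1] by (auto simp: c d)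
  have nz'': "r * w' - r' * w \<noteq> 0" using dets(6) by (auto simp: c d)
  have "r * w * (c1 * r + c2 * w) = 0" using zeros(3) by (simp add: c E c03 power2_eq_square algebra_simps)
  then have 1: "c1 * r + c2 * w = 0" using nz nz' by simp
  have "r' * w' * (c1 * r' + c2 * w') = 0" using zeros(4) by (simp add: d E c03 power2_eq_square algebra_simps)
  then have 2: "c1 * r' + c2 * w' = 0" using nz nz' by simp
  have "c1 * (r * w' - r' * w) = 0" "c2 * (r * w' - r' * w) = 0" using 1 2 by algebra+
  then have "c1 = 0" "c2 = 0" using nz'' by auto
  with E c03 show ?thesis by (intro form_zero_lin3[OF dets(1)]) simp
qed

lemma quadric_cone_three_roots:
  assumes F: "hom_form 2 F" "mult_ge F p 2"
    and zeros: "F a = 0" "F b = 0" "F c = 0"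
    and dets: "det3 p a b \<noteq> 0" "det3 p a c \<noteq> 0" "det3 p b c \<noteq> 0"
  shows "F = (\<lambda>_. 0)"
proof -
  obtain c0 c1 c2 where
    E: "\<And>z r w. F (lin3 p a b z r w) = c0 * r^2 + c1 * r * w + c2 * w^2"
    using quadric_double[OF F, where B = a and C = b] by blast
  have c02: "c0 = 0" "c2 = 0" using E[of 0 1 0] E[of 0 0 1] zeros by auto
  obtain z r w where c: "c = lin3 p a b z r w" using lin3_coords[OF dets(1)] by blast
  have nz: "w \<noteq> 0" using dets(2) by (auto simp: c)
  have nz': "r \<noteq> 0"
    using dets(3) det3_lin3_lin3[of p a b 0 0 1] by (auto simp: c)
  have "r * w * c1 = 0" using zeros(3) by (simp add: c E c02 algebra_simps)
  then have 1: "c1 = 0" using nz nz' by simp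
  with E c02 show ?thesis by (intro form_zero_lin3[OF dets(1)]) simp
qed

text \<open>The line from \<open>p\<close> to the double point \<open>a\<close> is a double root of
  the binary cubic, so two further roots are already too many.\<close>

lemma cubic_cone_double_root:
  assumes F: "hom_form 3 F" "mult_ge F p 3"
    and zeros: "mult_ge F a 2" "F b = 0" "F c = 0"
    and dets: "det3 p a b \<noteq> 0" "det3 p a c \<noteq> 0" "det3 p b c \<noteq> 0"
  shows "F = (\<lambda>_. 0)"
proof -
  obtain c0 c1 c2 c3 where
    E: "\<And>z r w. F (lin3 p a b z r w) = c0 * r^3 + c1 * r^2 * w + c2 * r * w^2 + c3 * w^3"
    using cubic_triple[OF F, where B = a and C = b] by blast
  have c3: "c3 = 0" using E[of 0 0 1] zeros by auto
  obtain c120 c111 c102 c030 c021 c012 c003 where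
    "\<And>z r w. F (lin3 a p b z r w) =
      c120 * z * r^2 + c111 * z * r * w + c102 * z * w^2 +
      c030 * r^3 + c021 * r^2 * w + c012 * r * w^2 + c003 * w^3"
    using cubic_double[OF F(1) zeros(1), where B = p and C = b] by blast
  then have E': "\<And>z r w. F (lin3 p a b z r w) =
      c120 * r * z^2 + c111 * z * r * w + c102 * r * w^2 +
      c030 * z^3 + c021 * z^2 * w + c012 * z * w^2 + c003 * w^3"
    by (simp add: lin3_swap(2)[of p a b] algebra_simps)
  \<comment> \<open>On \<open>z = 0\<close> the expansion at \<open>a\<close> is linear in
    \<open>r\<close>, so the coefficients of \<open>r^3\<close> and \<open>r^2 * w\<close> in the
    expansion at \<open>p\<close> vanish. Evaluation at a few points carries out this
    comparison.\<close>
  have 0: "c0 = 0" using E[of 0 1 0] E'[of 0 1 0] by simp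
  have "c0 + c1 + c2 + c3 = c102 + c003" using E[of 0 1 1] E'[of 0 1 1] by simp
  moreover have "- c0 + c1 - c2 + c3 = - c102 + c003" using E[of 0 "-1" 1] E'[of 0 "-1" 1] by simp
  moreover have "c003 = c3" using E[of 0 0 1] E'[of 0 0 1] by simp
  ultimately have c01: "c0 = 0" "c1 = 0" using 0 c3 by algebra+
  obtain z r w where c: "c = lin3 p a b z r w" using lin3_coords[OF dets(1)] by blast
  have nz: "w \<noteq> 0" using dets(2) by (auto simp: c)
  have nz': "r \<noteq> 0"
    using dets(3) det3_lin3_lin3[of p a b 0 0 1] by (auto simp: c)
  have "r * w^2 * c2 = 0" using zeros(3) by (simp add: c E c01 c3 algebra_simps)
  then have 1: "c2 = 0" using nz nz' by simp
  with E c01 c3 show ?thesis by (intro form_zero_lin3[OF dets(1)]) simp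
qed

section \<open>Lines given by linear forms\<close>

text \<open>The kernel of \<open>l\<close> is a plane; of two independent vectors in it, at least
  one is no multiple of \<open>p\<close>.\<close>

lemma kernel_vector:
  assumes "normalized l"
  obtains R where "dotp l R = 0" "\<not> (\<exists>c. R = smul c p)"
proof -
  obtain a b c where l: "l = (a,b,c)" by (metis prod_cases3)
  obtain x y z where p: "p = (x,y,z)" by (metis prod_cases3)
  have indep: "\<not> ((\<exists>c. A = smul c p) \<and> (\<exists>c. B = smul c p))"
    if "det3 A B v \<noteq> 0" for A B v
    using that by (auto simp: p vec_defs algebra_simps)
  have "\<exists>A B v. dotp l A = 0 \<and> dotp l B = 0 \<and> det3 A B v \<noteq> 0"
  proof -
    consider "a = 1" | "a = 0" "b = 1" | "a = 0" "b = 0" "c = 1"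
      using assms by (auto simp: normalized_def l)
    then show ?thesis
    proof cases
      case 1 then show ?thesis
        by (intro exI[of _ "(-b,1,0)"] exI[of _ "(-c,0,1)"] exI[of _ "(1,0,0)"]) (simp add: l vec_defs)
    next
      case 2 then show ?thesis
        by (intro exI[of _ "(1,0,0)"] exI[of _ "(0,-c,1)"] exI[of _ "(0,1,0)"]) (simp add: l vec_defs)
    next
      case 3 then show ?thesis
        by (intro exI[of _ "(1,0,0)"] exI[of _ "(0,1,0)"] exI[of _ "(0,0,1)"]) (simp add: l vec_defs)
    qed
  qed
  with indep that show ?thesis by blast
qed

lemma off_kernel_vector:
  assumes "normalized l"
  obtains W where "dotp l W \<noteq> 0"
proof -
  obtain a b c where l: "l = (a,b,c)" by (metis prod_cases3)
  consider "a \<noteq> 0" | "b \<noteq> 0" | "c \<noteq> 0" using assms by (auto simp: normalized_def l)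
  then show ?thesis
    by cases (auto intro: that[of "(1,0,0)"] that[of "(0,1,0)"] that[of "(0,0,1)"] simp: l vec_defs)
qed

lemma dotp_lin3: "dotp l (lin3 A B C z r w) = z * dotp l A + r * dotp l B + w * dotp l C"
  by (cases l; cases A; cases B; cases C; simp add: vec_defs algebra_simps)

lemma proportional_if_dependent:
  assumes "p \<noteq> (0,0,0)" "\<forall>v. det3 p R v = 0"
  shows "\<exists>c. R = smul c p"
proof -
  obtain x y z where p: "p = (x,y,z)" by (metis prod_cases3)
  obtain a b c where R: "R = (a,b,c)" by (metis prod_cases3)
  have e: "x * b = y * a" "x * c = z * a" "y * c = z * b"
    using assms(2)[rule_format, of "(0,0,1)"] assms(2)[rule_format, of "(0,1,0)"]
      assms(2)[rule_format, of "(1,0,0)"] by (auto simp: p R vec_defs)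
  consider "x \<noteq> 0" | "y \<noteq> 0" | "z \<noteq> 0" using assms(1) p by auto
  then show ?thesis
  proof cases
    case 1 then show ?thesis using e by (intro exI[of _ "a/x"]) (auto simp: p R vec_defs field_simps)
  next
    case 2 then show ?thesis using e by (intro exI[of _ "b/y"]) (auto simp: p R vec_defs field_simps)
  next
    case 3 then show ?thesis using e by (intro exI[of _ "c/z"]) (auto simp: p R vec_defs field_simps)
  qed
qed

text \<open>If \<open>p\<close> and \<open>R\<close> are independent, \<open>det3 p R\<close> and
  \<open>dotp l\<close> are linear forms killing the same plane, hence proportional, and this is
  stated without division. Otherwise both sides are 0.\<close>

lemma kernel_det3:
  assumes "dotp l p = 0" "dotp l R = 0"
  shows "dotp l W * det3 p R v = dotp l v * det3 p R W"
proof -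
  obtain l1 l2 l3 p1 p2 p3 r1 r2 r3 w1 w2 w3 v1 v2 v3
    where eq: "l = (l1,l2,l3)" "p = (p1,p2,p3)" "R = (r1,r2,r3)" "W = (w1,w2,w3)" "v = (v1,v2,v3)"
    by (metis prod_cases3)
  have "l1 * p1 + l2 * p2 + l3 * p3 = 0" "l1 * r1 + l2 * r2 + l3 * r3 = 0"
    using assms by (auto simp: eq vec_defs)
  then show ?thesis unfolding eq vec_defs prod.case by algebra
qed

text \<open>Guarantees that the frames of the blow-up chart are bases: the centre \<open>p\<close>,
  a vector \<open>R\<close> on the line \<open>l\<close>, a vector \<open>W\<close> off it.\<close>

lemma kernel_basis:
  assumes "p \<noteq> (0,0,0)" "dotp l p = 0" "dotp l R = 0" "\<not> (\<exists>c. R = smul c p)" "dotp l W \<noteq> 0"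
  shows "det3 p R W \<noteq> 0"
proof
  assume 0: "det3 p R W = 0"
  have "\<forall>v. det3 p R v = 0" using kernel_det3[OF assms(2,3), of W] 0 assms(5) by (metis mult_eq_0_iff)
  then show False using proportional_if_dependent assms by blast
qed

lemma normalized_proportional:
  assumes "normalized u" "normalized v" "\<And>w. det3 u v w = 0"
  shows "u = v"
proof -
  obtain x y z where u: "u = (x,y,z)" by (metis prod_cases3)
  obtain a b c where v: "v = (a,b,c)" by (metis prod_cases3)
  have e: "x * b = y * a" "x * c = z * a" "y * c = z * b"
    using assms(3)[of "(0,0,1)"] assms(3)[of "(0,1,0)"] assms(3)[of "(1,0,0)"]
    by (auto simp: u v vec_defs)
  then show ?thesis using assms(1,2) by (auto simp: normalized_def u v)
qed

text \<open>The line through \<open>p\<close> and \<open>R\<close> determines its equation up to a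
  scalar, and normalization fixes the scalar. The ratio is read off at a vector \<open>v\<close> off
  the line.\<close>

lemma normalized_eqI:
  assumes "normalized l" "normalized l'" "p \<noteq> (0,0,0)" "\<not> (\<exists>c. R = smul c p)"
    "dotp l p = 0" "dotp l R = 0" "dotp l' p = 0" "dotp l' R = 0"
  shows "l = l'"
proof -
  obtain v where v: "det3 p R v \<noteq> 0" using proportional_if_dependent assms by blast
  have nz: "dotp k v \<noteq> 0" if k: "normalized k" "dotp k p = 0" "dotp k R = 0" for k
  proof
    assume "dotp k v = 0"
    then have "dotp k W = 0" for W using kernel_det3[OF k(2,3), of W v] v by simp
    then show False using off_kernel_vector[OF k(1)] by blast
  qed
  have *: "dotp l W * dotp l' v = dotp l' W * dotp l v" for W
  proof -
    have "(dotp l W * dotp l' v - dotp l' W * dotp l v) * det3 p R v = 0"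
      using kernel_det3[OF assms(5,6), of W v] kernel_det3[OF assms(7,8), of W v] by algebra
    then show ?thesis using v by simp
  qed
  obtain a b c a' b' c' where l: "l = (a,b,c)" "l' = (a',b',c')" by (metis prod_cases3)
  define k k' where "k = dotp l v" and "k' = dotp l' v"
  have k: "k \<noteq> 0" "k' \<noteq> 0" using nz assms unfolding k_def k'_def by auto
  have "a * k' = a' * k" "b * k' = b' * k" "c * k' = c' * k"
    using *[of "(1,0,0)"] *[of "(0,1,0)"] *[of "(0,0,1)"] unfolding k_def[symmetric] k'_def[symmetric]
    by (simp_all add: l vec_defs)
  then show ?thesis using assms(1,2) k by (auto simp: l normalized_def)
qed

subsection \<open>Cubics with a triple point\<close>

lemma hom_form_quadric: "hom_form 2 (\<lambda>(z,r,w). c200 * z^2 + c110 * z * r + c101 * z * w +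
    c020 * r^2 + c011 * r * w + c002 * w^2)"
proof -
  have "hom_form 2 (\<lambda>v. c200 * (case v of (z,r,w) \<Rightarrow> z^2 * r^0 * w^0) +
    c110 * (case v of (z,r,w) \<Rightarrow> z^1 * r^1 * w^0) + c101 * (case v of (z,r,w) \<Rightarrow> z^1 * r^0 * w^1) +
    c020 * (case v of (z,r,w) \<Rightarrow> z^0 * r^2 * w^0) + c011 * (case v of (z,r,w) \<Rightarrow> z^0 * r^1 * w^1) +
    c002 * (case v of (z,r,w) \<Rightarrow> z^0 * r^0 * w^2))"
    by (intro hom_form_add hom_form_cmult hom_form_monomial) auto
  then show ?thesis by (simp add: case_prod_unfold mult.assoc)
qed

text \<open>A converse to \<open>quadric_expand\<close>: by Cramer's rule the coordinates are linear
  forms, which are substituted into the polynomial. It turns the residual factor of a cubic into a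
  conic.\<close>

lemma quadric_in_coords:
  assumes "det3 A B C \<noteq> 0"
  obtains G where "hom_form 2 G"
    "\<And>z r w. G (lin3 A B C z r w) = c200 * z^2 + c110 * z * r + c101 * z * w +
      c020 * r^2 + c011 * r * w + c002 * w^2"
proof -
  let ?k = "1 / det3 A B C"
  let ?G = "\<lambda>v. (case (?k * det3 B C v, ?k * det3 C A v, ?k * det3 A B v) of (z,r,w) \<Rightarrow>
      c200 * z^2 + c110 * z * r + c101 * z * w + c020 * r^2 + c011 * r * w + c002 * w^2)"
  have "hom_form (2 * 1) ?G"
    by (intro hom_form_compose hom_form_quadric hom_form_cmult hom_form_det3)
  moreover have "det3 B C (lin3 A B C z r w) = z * det3 A B C"
    "det3 C A (lin3 A B C z r w) = r * det3 A B C" for z r w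
    using det3_lin3(2)[of A B C z r w] det3_lin3(3)[of A B C z r w]
    by (metis det3_cyclic)+
  ultimately show ?thesis using assms by (intro that[of ?G]) simp_all
qed

section \<open>General position and pairing of the six points\<close>

lemma general_position_det:
  assumes "general_position P" "i \<in> {1..6}" "j \<in> {1..6}" "k \<in> {1..6}" "i \<noteq> j" "i \<noteq> k" "j \<noteq> k"
  shows "det3 (P i) (P j) (P k) \<noteq> 0"
  using assms unfolding general_position_def by blast

lemma general_position_conic:
  assumes "general_position P" "hom_form 2 G" "\<And>i. i \<in> {1..6} \<Longrightarrow> G (P i) = 0"
  shows "G = (\<lambda>_. 0)"
  using assms unfolding general_position_def by blast

lemma four_elements:
  assumes "4 \<le> card S"
  obtains a b c d where "{a,b,c,d} \<subseteq> S" "distinct [a,b,c,d]"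
proof -
  obtain T where T: "T \<subseteq> S" "card T = 4" "finite T" using obtain_subset_with_card_n[OF assms] by metis
  then obtain xs where "set xs = T" "distinct xs" "length xs = 4"
    using finite_distinct_list[of T] distinct_card by metis
  then show ?thesis using T
    by (auto simp: numeral_eq_Suc length_Suc_conv intro: that)
qed

text \<open>The indices \<open>i\<close> and \<open>j\<close> may coincide; several calls use the
  lemma to avoid a single index.\<close>

lemma six_indices_minus:
  assumes "i \<in> {1..6::nat}" "j \<in> {1..6}"
  obtains a b c d where "{a,b,c,d} \<subseteq> {1..6} - {i,j}" "distinct [a,b,c,d]"
proof -
  have "card ({1..6} - {i,j}) = card {1..6::nat} - card {i,j}"
    using assms by (intro card_Diff_subset) auto
  then have "4 \<le> card ({1..6} - {i,j})"
    using card_insert_le_m1[of 2 "{j}" i] by simp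
  then show ?thesis using that by (rule four_elements)
qed

lemma general_position_nonzero:
  assumes "general_position P" "i \<in> {1..6}"
  shows "P i \<noteq> (0,0,0)"
proof -
  obtain a b c d where "{a,b,c,d} \<subseteq> {1..6} - {i,i}" "distinct [a,b,c,d]"
    by (rule six_indices_minus[OF assms(2) assms(2)])
  then have "det3 (P i) (P a) (P b) \<noteq> 0" using general_position_det[OF assms] by auto
  then show ?thesis by auto
qed

text \<open>If \<open>P i\<close>, \<open>P j\<close>, \<open>P k\<close> are not collinear, two
  distinct lines through \<open>P i\<close> meet only there, so \<open>p\<close> would be the
  blown-up point \<open>P i\<close>.\<close>

lemma ordinary_partner_unique:
  assumes gp: "general_position P" and p: "valid_pt P (Ord p)"
    and ijk: "i \<in> {1..6}" "j \<in> {1..6}" "k \<in> {1..6}" "i \<noteq> j" "i \<noteq> k"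
    and zero: "det3 p (P i) (P j) = 0" "det3 p (P i) (P k) = 0"
  shows "j = k"
proof (rule ccontr)
  assume "j \<noteq> k"
  then have D: "det3 (P i) (P j) (P k) \<noteq> 0" using general_position_det[OF gp] ijk by blast
  obtain z r w where e: "p = lin3 (P i) (P j) (P k) z r w" using lin3_coords[OF D] by blast
  have "det3 (P i) (P j) p = 0" "det3 (P i) p (P k) = 0"
    using zero det3_cyclic[of p "P i" "P j"] det3_swap(1)[of p "P i" "P k"] by auto
  then have "w = 0" "r = 0" using D unfolding e by auto
  then have "p = smul z (P i)" by (simp add: e)
  then show False using p ijk by auto
qed

text \<open>\<open>E\<close> is a graph in which a vertex has at most one neighbour and any four
  vertices span an edge. Two edges are found greedily, in \<open>S\<close> and in the four vertices
  then left.\<close>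

lemma perfect_matching_six:
  fixes S :: "nat set"
  assumes S: "finite S" "card S = 6"
    and sym: "\<And>i j. E i j \<Longrightarrow> E j i"
    and uniq: "\<And>i j k. \<lbrakk>i \<in> S; j \<in> S; k \<in> S; i \<noteq> j; i \<noteq> k; E i j; E i k\<rbrakk> \<Longrightarrow> j = k"
    and indep: "\<And>a b c d. \<lbrakk>{a,b,c,d} \<subseteq> S; distinct [a,b,c,d]\<rbrakk> \<Longrightarrow>
      E a b \<or> E a c \<or> E a d \<or> E b c \<or> E b d \<or> E c d"
  obtains i j k l m n where "{i,j,k,l,m,n} = S" "distinct [i,j,k,l,m,n]" "E i j" "E k l" "E m n"
proof -
  have pair: "\<exists>i j. i \<in> T \<and> j \<in> T \<and> i \<noteq> j \<and> E i j" if T: "T \<subseteq> S" "4 \<le> card T" for T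
  proof -
    obtain a b c d where abcd: "{a,b,c,d} \<subseteq> T" "distinct [a,b,c,d]" using four_elements[OF T(2)] by metis
    with indep[of a b c d] T(1) show ?thesis by (metis distinct_length_2_or_more insert_subset subset_trans)
  qed
  obtain i j where ij: "i \<in> S" "j \<in> S" "i \<noteq> j" "E i j" using pair[of S] S by auto
  have c4: "card (S - {i,j}) = 4" using ij S by (simp add: card_Diff_subset)
  then obtain k l where kl: "k \<in> S - {i,j}" "l \<in> S - {i,j}" "k \<noteq> l" "E k l"
    using pair[of "S - {i,j}"] by auto
  have "card (S - {i,j} - {k,l}) = 2" using kl c4 S by (subst card_Diff_subset) auto
  then obtain m n where mn: "S - {i,j} - {k,l} = {m,n}" "m \<noteq> n" by (meson card_2_iff)
  have mn': "m \<in> S" "n \<in> S" "m \<notin> {i,j,k,l}" "n \<notin> {i,j,k,l}" using mn by auto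
  \<comment> \<open>One endpoint of each known edge is put together with the two leftover vertices;
    the endpoints already have their partners, so only the edge \<open>m n\<close> remains.\<close>
  have "E i k \<or> E i m \<or> E i n \<or> E k m \<or> E k n \<or> E m n"
    using indep[of i k m n] ij kl mn' mn(2) by auto
  moreover have "\<not> E i k" "\<not> E i m" "\<not> E i n" using uniq[of i j] ij kl mn' by blast+
  moreover have "\<not> E k m" "\<not> E k n" using uniq[of k l] kl mn' by blast+
  ultimately have "E m n" by blast
  moreover have "{i,j,k,l,m,n} = S" using ij kl mn by auto
  ultimately show ?thesis using that[of i j k l m n] ij kl mn mn' by auto
qed

lemma ordinary_triple_imp_cond_a:
  assumes gp: "general_position P" and p: "valid_pt P (Ord p)"
    and F: "hom_form 3 F" "F \<noteq> (\<lambda>_. 0)" "\<And>i. i \<in> {1..6} \<Longrightarrow> F (P i) = 0" "mult_ge F p 3"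
  shows "cond_a P (Ord p)"
proof -
  define E where "E i j \<longleftrightarrow> det3 p (P i) (P j) = 0" for i j
  obtain i j k l m n where 1: "{i,j,k,l,m,n} = {1..6}" "distinct [i,j,k,l,m,n]" "E i j" "E k l" "E m n"
  proof (rule perfect_matching_six[of "{1..6}" E])
    show "E i j \<Longrightarrow> E j i" for i j unfolding E_def by (subst det3_swap(2)) simp
    show "j = k" if "i \<in> {1..6}" "j \<in> {1..6}" "k \<in> {1..6}" "i \<noteq> j" "i \<noteq> k" "E i j" "E i k" for i j k
      using ordinary_partner_unique[OF gp p that(1-5)] that(6,7) unfolding E_def by blast
    show "E a b \<or> E a c \<or> E a d \<or> E b c \<or> E b d \<or> E c d"
      if "{a,b,c,d} \<subseteq> {1..6}" "distinct [a,b,c,d]" for a b c d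
      using cubic_cone_four_roots[OF F(1,4), of "P a" "P b" "P c" "P d"] F(2,3) that
      unfolding E_def by auto
  qed auto
  have "det3 (P i) (P j) p = 0" "det3 (P k) (P l) p = 0" "det3 (P m) (P n) p = 0"
    using 1(3-5) unfolding E_def by (simp_all add: det3_cyclic[of p])
  moreover have "card {i,j,k,l,m,n} = 6" "{i,j,k,l,m,n} \<subseteq> {1..6}" unfolding 1(1) by simp_all
  ultimately show ?thesis unfolding cond_a_def line_form_def on_transform.simps
    by (intro exI conjI)
qed

section \<open>Triple points on the exceptional curves\<close>

text \<open>Along the arcs \<open>z\<close>, \<open>r\<close>, \<open>w\<close> have weights 0, 1,
  2. Vanishing to order \<open>1 + 3 = 4\<close> removes exactly the monomials of weight below 4,
  and those that survive are divisible by \<open>w\<close>.\<close>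

lemma exceptional_triple:
  assumes F: "hom_form 3 F" "div_mult_ge P 1 F (Exc i l) 3"
    and R: "dotp l R = 0" "\<not> (\<exists>c. R = smul c (P i))" "dotp l W \<noteq> 0"
  obtains c102 c021 c012 c003 where "\<And>z r w. F (lin3 (P i) R W z r w) =
    w * (c102 * z * w + c021 * r^2 + c012 * r * w + c003 * w^2)"
proof -
  obtain c300 c210 c201 c120 c111 c102 c030 c021 c012 c003 where
    E: "\<And>z r w. F (lin3 (P i) R W z r w) = c300 * z^3 + c210 * z^2 * r + c201 * z^2 * w +
      c120 * z * r^2 + c111 * z * r * w + c102 * z * w^2 +
      c030 * r^3 + c021 * r^2 * w + c012 * r * w^2 + c003 * w^3"
    using cubic_expand[OF F(1)] by blast
  have arc: "\<exists>q. \<forall>s. F (lin3 (P i) R W 1 (s*a) (s*a*(s*b))) = s^4 * poly q s" if "a \<noteq> 0" for a b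
    using div_mult_ge_lin3[THEN iffD1, OF F(2), rule_format, of R W a b] R that by simp
  \<comment> \<open>The arc with \<open>b = 0\<close> stays in \<open>w = 0\<close>. It separates
    \<open>c120\<close> from \<open>c201\<close> and \<open>c030\<close> from \<open>c111\<close>,
    which share a weight on the second arc.\<close>
  obtain q where q: "\<And>s. F (lin3 (P i) R W 1 (s*1) (s*1*(s*0))) = s^4 * poly q s"
    using arc[of 1 0] by auto
  have "poly [:c300, c210, c120, c030:] s = s^4 * poly q s" for s
    using q[of s] by (simp add: E algebra_simps power2_eq_square power3_eq_cube)
  note c1 = poly_low_coeffs[OF this]
  obtain q where q: "\<And>s. F (lin3 (P i) R W 1 (s*1) (s*1*(s*1))) = s^4 * poly q s"
    using arc[of 1 1] by auto
  have "poly [:c300, c210, c120 + c201, c030 + c111, c102 + c021, c012, c003:] s = s^4 * poly q s" for s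
    using q[of s] by (simp add: E algebra_simps eval_nat_numeral)
  note c2 = poly_low_coeffs[OF this]
  have "c300 = 0" "c210 = 0" "c120 = 0" "c030 = 0" "c201 = 0" "c111 = 0"
    using c1[of 0] c1[of 1] c1[of 2] c1[of 3] c2[of 2] c2[of 3] by (simp_all add: numeral_eq_Suc)
  with E have "\<And>z r w. F (lin3 (P i) R W z r w) =
      w * (c102 * z * w + c021 * r^2 + c012 * r * w + c003 * w^2)"
    by (simp add: algebra_simps power2_eq_square power3_eq_cube)
  then show ?thesis by (rule that)
qed

lemma exceptional_basis:
  assumes "general_position P" "valid_pt P (Exc i l)"
  obtains R W where "dotp l R = 0" "\<not> (\<exists>c. R = smul c (P i))" "dotp l W \<noteq> 0"
    "det3 (P i) R W \<noteq> 0"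
proof -
  obtain R where R: "dotp l R = 0" "\<not> (\<exists>c. R = smul c (P i))"
    using kernel_vector[of l "P i"] assms(2) by auto
  obtain W where W: "dotp l W \<noteq> 0" using off_kernel_vector[of l] assms(2) by auto
  have "det3 (P i) R W \<noteq> 0"
    using assms by (intro kernel_basis[OF _ _ R W] general_position_nonzero) auto
  with R W show ?thesis by (rule that)
qed

lemma mult_ge_if_lin3:
  assumes "det3 A B C \<noteq> 0"
    and "\<And>z r w. \<exists>q. \<forall>t. F (lin3 A B C (1 + t*z) (t*r) (t*w)) = t^m * poly q t"
  shows "mult_ge F A m"
  unfolding mult_ge_def using lin3_coords[OF assms(1)] assms(2) by (metis line_lin3)

text \<open>The normal form in \<open>exceptional_triple\<close> has degree at most 1 in
  \<open>z\<close>.\<close>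

lemma exceptional_triple_double:
  assumes gp: "general_position P" and Q: "valid_pt P (Exc i l)"
    and F: "hom_form 3 F" "div_mult_ge P 1 F (Exc i l) 3"
  shows "mult_ge F (P i) 2"
proof -
  obtain R W where RW: "dotp l R = 0" "\<not> (\<exists>c. R = smul c (P i))" "dotp l W \<noteq> 0"
    "det3 (P i) R W \<noteq> 0"
    using exceptional_basis[OF gp Q] by blast
  obtain c102 c021 c012 c003 where E: "\<And>z r w. F (lin3 (P i) R W z r w) =
    w * (c102 * z * w + c021 * r^2 + c012 * r * w + c003 * w^2)"
    using exceptional_triple[OF F RW(1-3)] by blast
  show ?thesis
  proof (rule mult_ge_if_lin3[OF RW(4)])
    fix z r w
    show "\<exists>q. \<forall>t. F (lin3 (P i) R W (1 + t*z) (t*r) (t*w)) = t^2 * poly q t"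
      by (intro exI[of _ "[:c102 * w^2, w * (c102 * z * w + c021 * r^2 + c012 * r * w + c003 * w^2):]"])
        (simp add: E algebra_simps power2_eq_square)
  qed
qed

text \<open>The factor \<open>w\<close> of the normal form is the line \<open>l\<close>, the other
  factor the conic \<open>G\<close>. A point \<open>P j\<close> off \<open>G\<close> must lie on
  \<open>l\<close>; no third point does, so all the others lie on \<open>G\<close>.\<close>

lemma exceptional_triple_imp_cond_b:
  assumes gp: "general_position P" and Q: "valid_pt P (Exc i l)"
    and F: "hom_form 3 F" "F \<noteq> (\<lambda>_. 0)" "\<And>i. i \<in> {1..6} \<Longrightarrow> F (P i) = 0"
      "div_mult_ge P 1 F (Exc i l) 3"
  shows "cond_b P (Exc i l)"
proof -
  have i: "i \<in> {1..6}" "dotp l (P i) = 0" using Q by auto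
  obtain R W where RW: "dotp l R = 0" "\<not> (\<exists>c. R = smul c (P i))" "dotp l W \<noteq> 0"
    and D: "det3 (P i) R W \<noteq> 0"
    using exceptional_basis[OF gp Q] by blast
  note coords = lin3_coords[OF D]
  obtain c102 c021 c012 c003 where FE: "\<And>z r w. F (lin3 (P i) R W z r w) =
    w * (c102 * z * w + c021 * r^2 + c012 * r * w + c003 * w^2)"
    using exceptional_triple[OF F(1,4) RW] by blast
  obtain G where G: "hom_form 2 G" and GE': "\<And>z r w. G (lin3 (P i) R W z r w) =
    0 * z^2 + 0 * z * r + c102 * z * w + c021 * r^2 + c012 * r * w + c003 * w^2"
    using quadric_in_coords[OF D] by blast
  have GE: "G (lin3 (P i) R W z r w) = c102 * z * w + c021 * r^2 + c012 * r * w + c003 * w^2" for z r w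
    using GE' by simp
  have G0: "G \<noteq> (\<lambda>_. 0)"
  proof
    assume "G = (\<lambda>_. 0)"
    then have "F (lin3 (P i) R W z r w) = 0" for z r w using FE[of z r w] GE[of z r w] by simp
    then show False using F(2) form_zero_lin3[OF D] by blast
  qed
  have Gi: "G (P i) = 0" using GE[of 1 0 0] by simp
  obtain j where j: "j \<in> {1..6}" "G (P j) \<noteq> 0"
    using general_position_conic[OF gp G] G0 by blast
  have ij: "i \<noteq> j" using j Gi by auto
  obtain z0 r0 w0 where Pj: "P j = lin3 (P i) R W z0 r0 w0" by (rule coords)
  have "w0 = 0" using F(3)[OF j(1)] j(2) unfolding Pj FE GE by auto
  note Pj = Pj[unfolded this]
  have lj: "dotp l (P j) = 0" unfolding Pj using i RW by (simp add: dotp_lin3)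
  have Gk: "G (P k) = 0" if k: "k \<in> {1..6} - {j}" for k
  proof (cases "k = i")
    case False
    obtain z r w where Pk: "P k = lin3 (P i) R W z r w" by (rule coords)
    have "det3 (P i) (P j) (P k) \<noteq> 0" using general_position_det[OF gp] i j k ij False by blast
    then have "w \<noteq> 0" unfolding Pj Pk by auto
    then show ?thesis using F(3)[of k] k unfolding Pk FE GE by auto
  qed (simp add: Gi)
  have conic: "conic_eq P j G" unfolding conic_eq_def using G G0 Gk by blast
  \<comment> \<open>At an exceptional point \<open>on_transform\<close> asks for order
    \<open>m + 1\<close> for every lower bound \<open>m\<close> of the multiplicity, while
    \<open>G\<close> restricted to \<open>l\<close> is only known to have order 2. So
    \<open>m\<close> must stay below 2; a double \<open>G\<close> would be a cone with three
    roots.\<close>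
  have not_double: "\<not> mult_ge G (P i) 2"
  proof
    assume 2: "mult_ge G (P i) 2"
    obtain a b c d where "{a,b,c,d} \<subseteq> {1..6} - {i,j}" "distinct [a,b,c,d]"
      by (rule six_indices_minus[OF i(1) j(1)])
    then have "G = (\<lambda>_. 0)"
      by (intro quadric_cone_three_roots[OF G 2, of "P a" "P b" "P c"] Gk
        general_position_det[OF gp i(1)]) auto
    then show False using G0 by blast
  qed
  have kernel: "\<exists>z r. v = lin3 (P i) R W z r 0" if "dotp l v = 0" for v
  proof -
    obtain z r w where v: "v = lin3 (P i) R W z r w" by (rule coords)
    then show ?thesis using that i RW by (auto simp: dotp_lin3)
  qed
  have "on_transform P (line_form P i j) (Exc i l)"
    unfolding on_transform.simps line_form_def
  proof (intro allI impI exI)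
    fix R' m t assume R': "dotp l R' = 0 \<and> \<not> (\<exists>c. R' = smul c (P i))"
    then obtain z r where "R' = lin3 (P i) R W z r 0" using kernel by blast
    \<comment> \<open>The line through \<open>P i\<close> and \<open>P j\<close> is \<open>l\<close>
      itself, so its form restricts to zero and the quotient 0 serves every
      \<open>m\<close>.\<close>
    then show "det3 (P i) (P j) (vadd (P i) (smul t R')) = t ^ Suc m * poly 0 t"
      unfolding Pj by (simp add: line_lin3)
  qed
  moreover have "on_transform P G (Exc i l)"
    unfolding on_transform.simps
  proof (intro allI impI)
    fix R' m assume R': "dotp l R' = 0 \<and> \<not> (\<exists>c. R' = smul c (P i))" and m: "mult_ge G (P i) m"
    have "m < 2" using not_double mult_ge_mono[OF m, of 2] by linarith
    then have "m = 0 \<or> m = 1" by linarith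
    moreover obtain z r where "R' = lin3 (P i) R W z r 0" using kernel R' by blast
    ultimately show "\<exists>q. \<forall>t. G (vadd (P i) (smul t R')) = t ^ Suc m * poly q t"
      \<comment> \<open>The restriction of \<open>G\<close> is \<open>c021 * r^2 * t^2\<close>, and
        \<open>2 = Suc m + (1 - m)\<close> for both values of \<open>m\<close>.\<close>
      by (intro exI[of _ "monom (c021 * r^2) (1 - m)"])
        (auto simp: line_lin3 GE poly_monom power2_eq_square algebra_simps)
  qed
  moreover have "\<exists>q. \<forall>t. G (vadd (P i) (smul t (P j))) = t^2 * poly q t"
    unfolding Pj by (intro exI[of _ "[:c021 * r0^2:]"]) (simp add: line_lin3 GE power2_eq_square algebra_simps)
  ultimately show ?thesis unfolding cond_b_def
    using i(1) j(1) ij conic by (intro exI[of _ i] exI[of _ j]) auto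
qed

section \<open>A cubic has at most one such triple point\<close>

text \<open>In a basis \<open>p\<close>, \<open>p'\<close>, \<open>P k\<close> the form would
  involve neither \<open>z\<close> nor \<open>r\<close>, and the remaining \<open>w^3\<close> is
  excluded by \<open>F (P k) = 0\<close>. So every \<open>P k\<close> is dependent on
  \<open>p\<close> and \<open>p'\<close>, which for three noncollinear points forces
  \<open>p = p'\<close>.\<close>

lemma triple_points_ordinary_ordinary:
  assumes gp: "general_position P" and pp: "normalized p" "normalized p'"
    and F: "hom_form 3 F" "F \<noteq> (\<lambda>_. 0)" "\<And>i. i \<in> {1..6} \<Longrightarrow> F (P i) = 0"
      "mult_ge F p 3" "mult_ge F p' 3"
  shows "p = p'"
proof (rule normalized_proportional[OF pp])
  have zero: "det3 p p' (P k) = 0" if k: "k \<in> {1..6}" for k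
  proof (rule ccontr)
    assume D: "det3 p p' (P k) \<noteq> 0"
    obtain c030 c021 c012 c003 where
      E: "\<And>z r w. F (lin3 p p' (P k) z r w) = c030 * r^3 + c021 * r^2 * w + c012 * r * w^2 + c003 * w^3"
      using cubic_triple[OF F(1,4)] by blast
    obtain d030 d021 d012 d003 where
      "\<And>z r w. F (lin3 p' p (P k) z r w) = d030 * r^3 + d021 * r^2 * w + d012 * r * w^2 + d003 * w^3"
      using cubic_triple[OF F(1,5)] by blast
    then have E': "\<And>z r w. F (lin3 p p' (P k) z r w) = d030 * z^3 + d021 * z^2 * w + d012 * z * w^2 + d003 * w^3"
      by (subst lin3_swap(2)) simp
    have "F (lin3 p p' (P k) z r w) = 0" for z r w
    proof -
      have "F (lin3 p p' (P k) z r w) = F (lin3 p p' (P k) 0 r w)" by (simp only: E)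
      also have "\<dots> = d003 * w^3" by (simp add: E')
      also have "d003 = 0" using E'[of 0 0 1] F(3)[OF k] by simp
      finally show ?thesis by simp
    qed
    then show False using F(2) form_zero_lin3[OF D] by blast
  qed
  have D: "det3 (P 1) (P 2) (P 3) \<noteq> 0" using general_position_det[OF gp] by simp
  show "det3 p p' v = 0" for v
  proof -
    obtain z r w where "v = lin3 (P 1) (P 2) (P 3) z r w" using lin3_coords[OF D] by blast
    then show ?thesis using zero[of 1] zero[of 2] zero[of 3] by (simp add: det3_lin3_right)
  qed
qed

lemma no_triple_points_ordinary_exceptional:
  assumes gp: "general_position P" and Q: "valid_pt P (Ord p)" "valid_pt P (Exc i l)"
    and F: "hom_form 3 F" "F \<noteq> (\<lambda>_. 0)" "\<And>i. i \<in> {1..6} \<Longrightarrow> F (P i) = 0"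
      "mult_ge F p 3" "div_mult_ge P 1 F (Exc i l) 3"
  shows False
proof -
  have i: "i \<in> {1..6}" using Q by auto
  define E where "E i j \<longleftrightarrow> det3 p (P i) (P j) = 0" for i j
  have uniq: "j = k" if "i \<in> {1..6}" "j \<in> {1..6}" "k \<in> {1..6}" "i \<noteq> j" "i \<noteq> k" "E i j" "E i k" for i j k
    using ordinary_partner_unique[OF gp Q(1) that(1-5)] that(6,7) unfolding E_def by blast
  \<comment> \<open>The index \<open>i'\<close> is the partner of \<open>i\<close> on a line through
    \<open>p\<close>, or \<open>i\<close> itself when there is none.\<close>
  obtain i' where i': "i' \<in> {1..6}" "\<And>j. \<lbrakk>j \<in> {1..6} - {i,i'}\<rbrakk> \<Longrightarrow> \<not> E i j"
  proof (cases "\<exists>i'. i' \<in> {1..6} - {i} \<and> E i i'")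
    case True
    then obtain i' where "i' \<in> {1..6} - {i}" "E i i'" by blast
    then show ?thesis using uniq[of i i'] i by (intro that[of i']) auto
  next
    case False
    then show ?thesis using i by (intro that[of i]) auto
  qed
  obtain a b c d where abcd: "{a,b,c,d} \<subseteq> {1..6} - {i,i'}" "distinct [a,b,c,d]"
    by (rule six_indices_minus[OF i i'(1)])
  \<comment> \<open>\<open>a\<close> has at most one partner, so one of \<open>b\<close>,
    \<open>c\<close> lies on another line through \<open>p\<close>. This gives two simple roots
    beside the double root at \<open>P i\<close>.\<close>
  have "\<not> E a b \<or> \<not> E a c" using uniq[of a b c] abcd by auto
  then obtain k where k: "k \<in> {1..6} - {i,i'}" "\<not> E a k" using abcd by auto
  have "F = (\<lambda>_. 0)"
    using i'(2)[of a] i'(2)[of k] k abcd F(3)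
    by (intro cubic_cone_double_root[OF F(1,4) exceptional_triple_double[OF gp Q(2) F(1,5)], of "P a" "P k"])
       (auto simp: E_def)
  then show False using F(2) by blast
qed

text \<open>With \<open>P i\<close>, \<open>P j\<close>, \<open>P k\<close> as basis,
  \<open>F\<close> has degree at most 1 in \<open>z\<close> and in \<open>r\<close>; every such
  cubic monomial contains \<open>w\<close>, the equation of the line through \<open>P i\<close> and
  \<open>P j\<close>.\<close>

lemma double_points_unique:
  assumes gp: "general_position P" and ij: "i \<in> {1..6}" "j \<in> {1..6}"
    and F: "hom_form 3 F" "F \<noteq> (\<lambda>_. 0)" "\<And>i. i \<in> {1..6} \<Longrightarrow> F (P i) = 0"
      "mult_ge F (P i) 2" "mult_ge F (P j) 2"
  shows "i = j"
proof (rule ccontr)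
  assume ne: "i \<noteq> j"
  obtain k b c d where "{k,b,c,d} \<subseteq> {1..6} - {i,j}" "distinct [k,b,c,d]"
    by (rule six_indices_minus[OF ij])
  then have k: "k \<in> {1..6} - {i,j}" by auto
  let ?C = "P k"
  have D: "det3 (P i) (P j) ?C \<noteq> 0" using general_position_det[OF gp] ij ne k by blast
  obtain c120 c111 c102 c030 c021 c012 c003 where
    E: "\<And>z r w. F (lin3 (P i) (P j) ?C z r w) =
      c120 * z * r^2 + c111 * z * r * w + c102 * z * w^2 +
      c030 * r^3 + c021 * r^2 * w + c012 * r * w^2 + c003 * w^3"
    using cubic_double[OF F(1,4)] by blast
  obtain d120 d111 d102 d030 d021 d012 d003 where
    "\<And>z r w. F (lin3 (P j) (P i) ?C z r w) =
      d120 * z * r^2 + d111 * z * r * w + d102 * z * w^2 +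
      d030 * r^3 + d021 * r^2 * w + d012 * r * w^2 + d003 * w^3"
    using cubic_double[OF F(1,5)] by blast
  then have E': "\<And>z r w. F (lin3 (P i) (P j) ?C z r w) =
      d120 * r * z^2 + d111 * r * z * w + d102 * r * w^2 +
      d030 * z^3 + d021 * z^2 * w + d012 * z * w^2 + d003 * w^3"
    by (subst lin3_swap(2)) simp
  have 0: "c030 = 0" "d030 = 0" "c003 = d003"
    using E[of 0 1 0] E'[of 0 1 0] E[of 1 0 0] E'[of 1 0 0] E[of 0 0 1] E'[of 0 0 1] by simp_all
  \<comment> \<open>The expansion at \<open>P j\<close> is linear in \<open>r\<close>, so adding the
    values at \<open>r = 1\<close> and \<open>r = -1\<close> isolates the coefficient of
    \<open>r^2\<close> in the other expansion. The same is done for \<open>c021\<close>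
    below.\<close>
  have e1: "c120 = d120" using E[of 1 1 0] E'[of 1 1 0] 0 by simp
  have e2: "c120 = - d120" using E[of 1 "-1" 0] E'[of 1 "-1" 0] 0 by simp
  have "c120 + c120 = d120 + - d120" by (rule arg_cong2[OF e1 e2])
  then have 1: "c120 = 0" by simp
  have e1: "c021 + c012 = d102" using E[of 0 1 1] E'[of 0 1 1] 0 by simp
  have e2: "c021 - c012 = - d102" using E[of 0 "-1" 1] E'[of 0 "-1" 1] 0 by simp
  have "(c021 + c012) + (c021 - c012) = d102 + - d102" by (rule arg_cong2[OF e1 e2])
  then have "c021 = 0" by simp
  note c = 0 1 this
  obtain G where G: "hom_form 2 G" and GE': "\<And>z r w. G (lin3 (P i) (P j) ?C z r w) =
    0 * z^2 + c111 * z * r + c102 * z * w + 0 * r^2 + c012 * r * w + c003 * w^2"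
    using quadric_in_coords[OF D] by blast
  have GE: "G (lin3 (P i) (P j) ?C z r w) = c111 * z * r + c102 * z * w + c012 * r * w + c003 * w^2" for z r w
    using GE' by simp
  have FG: "F (lin3 (P i) (P j) ?C z r w) = w * G (lin3 (P i) (P j) ?C z r w)" for z r w
    unfolding E GE using c by (simp add: power2_eq_square power3_eq_cube algebra_simps)
  have "G (P n) = 0" if n: "n \<in> {1..6}" for n
  proof -
    consider "n = i" | "n = j" | "n \<noteq> i" "n \<noteq> j" by blast
    then show ?thesis
    proof cases
      case 1 then show ?thesis using GE[of 1 0 0] by simp
    next
      case 2 then show ?thesis using GE[of 0 1 0] by simp
    next
      case 3
      then have Dn: "det3 (P i) (P j) (P n) \<noteq> 0" using general_position_det[OF gp] ij ne n by blast
      obtain z r w where e: "P n = lin3 (P i) (P j) ?C z r w" using lin3_coords[OF D] by blast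
      have "w \<noteq> 0" using Dn unfolding e by auto
      then show ?thesis using F(3)[OF n] unfolding e FG by simp
    qed
  qed
  then have "G = (\<lambda>_. 0)" using general_position_conic[OF gp G] by blast
  then have "F = (\<lambda>_. 0)" using FG by (intro form_zero_lin3[OF D]) simp
  then show False using F(2) by blast
qed

text \<open>Vectors \<open>R\<close>, \<open>R'\<close> on the two lines each serve as the
  transversal for the other line. So \<open>F\<close> is divisible by \<open>w\<close> and by
  \<open>r\<close>, which leaves a cone with vertex \<open>P i\<close>, and the other points are too
  many roots.\<close>

lemma triple_points_same_exceptional:
  assumes gp: "general_position P" and Q: "valid_pt P (Exc i l)" "valid_pt P (Exc i l')"
    and F: "hom_form 3 F" "F \<noteq> (\<lambda>_. 0)" "\<And>i. i \<in> {1..6} \<Longrightarrow> F (P i) = 0"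
      "div_mult_ge P 1 F (Exc i l) 3" "div_mult_ge P 1 F (Exc i l') 3"
  shows "l = l'"
proof (rule ccontr)
  assume ne: "l \<noteq> l'"
  have i: "i \<in> {1..6}" "normalized l" "normalized l'" "dotp l (P i) = 0" "dotp l' (P i) = 0"
    using Q by auto
  note P0 = general_position_nonzero[OF gp i(1)]
  obtain R where R: "dotp l R = 0" "\<not> (\<exists>c. R = smul c (P i))" using kernel_vector[OF i(2)] by blast
  obtain R' where R': "dotp l' R' = 0" "\<not> (\<exists>c. R' = smul c (P i))" using kernel_vector[OF i(3)] by blast
  have lR': "dotp l R' \<noteq> 0" using normalized_eqI[OF i(2,3) P0 R'(2)] i R' ne by blast
  have l'R: "dotp l' R \<noteq> 0" using normalized_eqI[OF i(2,3) P0 R(2)] i R ne by blast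
  have D: "det3 (P i) R R' \<noteq> 0" by (rule kernel_basis[OF P0 i(4) R lR'])
  obtain c102 c021 c012 c003 where E: "\<And>z r w. F (lin3 (P i) R R' z r w) =
    w * (c102 * z * w + c021 * r^2 + c012 * r * w + c003 * w^2)"
    using exceptional_triple[OF F(1,4) R lR'] by blast
  obtain d102 d021 d012 d003 where "\<And>z r w. F (lin3 (P i) R' R z r w) =
    w * (d102 * z * w + d021 * r^2 + d012 * r * w + d003 * w^2)"
    using exceptional_triple[OF F(1,5) R' l'R] by blast
  then have E': "F (lin3 (P i) R R' z 0 w) = 0" for z w by (subst lin3_swap(1)) simp
  have c: "c102 = 0" "c003 = 0" using E[of 0 0 1] E'[of 0 1] E[of 1 0 1] E'[of 1 1] by auto
  have 3: "mult_ge F (P i) 3"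
  proof (rule mult_ge_if_lin3[OF D])
    fix z r w
    show "\<exists>q. \<forall>t. F (lin3 (P i) R R' (1 + t*z) (t*r) (t*w)) = t^3 * poly q t"
      by (intro exI[of _ "[:w * (c021 * r^2 + c012 * r * w):]"])
        (simp add: E c algebra_simps power2_eq_square power3_eq_cube)
  qed
  obtain a b c d where "{a,b,c,d} \<subseteq> {1..6} - {i,i}" "distinct [a,b,c,d]"
    by (rule six_indices_minus[OF i(1) i(1)])
  then have "F = (\<lambda>_. 0)"
    by (intro cubic_cone_four_roots[OF F(1) 3, of "P a" "P b" "P c" "P d"] F(3)
      general_position_det[OF gp i(1)]) auto
  then show False using F(2) by blast
qed

section \<open>Cubics realizing conditions (a) and (b)\<close>

lemma six_distinct_if_card:
  assumes "card {i,j,k,l,m,n} = 6"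
  shows "distinct [i,j,k,l,m,n]"
  using assms card_distinct[of "[i,j,k,l,m,n]"] by simp

lemma det3_form_mult_ge:
  assumes "det3 A B p = 0"
  shows "mult_ge (det3 A B) p 1"
  by (rule mult_ge_1[OF hom_form_det3 assms])

lemma det3_form_nonzero:
  assumes "det3 A B C \<noteq> 0"
  shows "det3 A B \<noteq> (\<lambda>_. 0)"
  using assms by (metis)

text \<open>The trivial multiplicity bound 0 in \<open>on_transform\<close> already yields vanishing
  to order 1.\<close>

lemma on_transform_exceptional_vanish:
  assumes Q: "valid_pt P (Exc i l)" and F: "hom_form e F" "on_transform P F (Exc i l)"
  shows "F (P i) = 0"
proof -
  obtain R where R: "dotp l R = 0" "\<not> (\<exists>c. R = smul c (P i))"
    using kernel_vector[of l "P i"] Q by auto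
  have "mult_ge F (P i) 0"
    unfolding mult_ge_def power_0 mult_1_left using hom_form_along_line[OF F(1)] by metis
  then obtain q where "\<And>t. F (vadd (P i) (smul t R)) = t ^ Suc 0 * poly q t"
    using F(2) R unfolding on_transform.simps by blast
  from this[of 0] show ?thesis by simp
qed

text \<open>The cubic is the product of the three lines, each of multiplicity 1 at
  \<open>Q\<close>.\<close>

lemma cond_a_imp_triple:
  assumes gp: "general_position P" and Q: "valid_pt P Q" and a: "cond_a P Q"
  shows "\<exists>F. hom_form 3 F \<and> F \<noteq> (\<lambda>_. 0) \<and> (\<forall>i\<in>{1..6}. F (P i) = 0) \<and> div_mult_ge P 1 F Q 3"
proof -
  obtain i j k l m n where sub: "{i,j,k,l,m,n} \<subseteq> {1..6}" and card: "card {i,j,k,l,m,n} = 6"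
    and tr: "on_transform P (det3 (P i) (P j)) Q" "on_transform P (det3 (P k) (P l)) Q"
      "on_transform P (det3 (P m) (P n)) Q"
    using a unfolding cond_a_def line_form_def by (elim exE conjE) (rule that)
  have set: "{i,j,k,l,m,n} = {1..6}" using card by (intro card_subset_eq sub) auto
  note dist = six_distinct_if_card[OF card]
  have mem: "i \<in> {1..6}" "j \<in> {1..6}" "k \<in> {1..6}" "l \<in> {1..6}" "m \<in> {1..6}" "n \<in> {1..6}"
    using sub by auto
  let ?A = "det3 (P i) (P j)" and ?B = "det3 (P k) (P l)" and ?C = "det3 (P m) (P n)"
  let ?F = "\<lambda>v. ?A v * (?B v * ?C v)"
  \<comment> \<open>If \<open>Q\<close> lay on the exceptional curve over \<open>P i0\<close>, all
    three lines would pass through \<open>P i0\<close>; but each contains only its own two of the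
    six points, and the pairs are disjoint.\<close>
  obtain p where p: "Q = Ord p"
  proof (cases Q)
    case (Exc i0 l0)
    note vanish = on_transform_exceptional_vanish[OF Q[unfolded Exc] hom_form_det3]
    have i0: "i0 \<in> {1..6}" using Q Exc by auto
    have "i0 \<in> {i,j} \<or> i0 \<in> {k,l}"
    proof (rule ccontr)
      assume "\<not> (i0 \<in> {i,j} \<or> i0 \<in> {k,l})"
      then have "det3 (P i) (P j) (P i0) \<noteq> 0"
        using dist by (intro general_position_det[OF gp mem(1,2) i0]) auto
      then show False using vanish tr(1) Exc by blast
    qed
    then have "i0 \<noteq> m" "i0 \<noteq> n" using dist by auto
    then have "det3 (P m) (P n) (P i0) \<noteq> 0"
      using dist by (intro general_position_det[OF gp mem(5,6) i0]) auto
    then show ?thesis using vanish tr(3) Exc by blast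
  qed auto
  have "?A p = 0" "?B p = 0" "?C p = 0" using tr unfolding p by auto
  note mult = this[THEN det3_form_mult_ge]
  have "?A \<noteq> (\<lambda>_. 0)"
    using dist by (intro det3_form_nonzero[of _ _ "P m"] general_position_det[OF gp] mem) auto
  moreover have "?B \<noteq> (\<lambda>_. 0)"
    using dist by (intro det3_form_nonzero[of _ _ "P m"] general_position_det[OF gp] mem) auto
  moreover have "?C \<noteq> (\<lambda>_. 0)"
    using dist by (intro det3_form_nonzero[of _ _ "P i"] general_position_det[OF gp] mem) auto
  ultimately have "?F \<noteq> (\<lambda>_. 0)"
    using hom_form_mult_nonzero[OF hom_form_det3 hom_form_mult[OF hom_form_det3 hom_form_det3]]
      hom_form_mult_nonzero[OF hom_form_det3 hom_form_det3] by blast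
  moreover have "hom_form 3 ?F"
    using hom_form_mult[OF hom_form_det3 hom_form_mult[OF hom_form_det3 hom_form_det3],
      of "P i" "P j" "P k" "P l" "P m" "P n"] by (simp add: numeral_3_eq_3)
  moreover have "?F (P r) = 0" if "r \<in> {1..6}" for r
  proof -
    have "r \<in> {i,j,k,l,m,n}" using that set by simp
    then show ?thesis by auto
  qed
  moreover have "div_mult_ge P 1 ?F Q 3"
    using mult_ge_mult[OF mult(1) mult_ge_mult[OF mult(2,3)]] unfolding p div_mult_ge.simps by (simp add: numeral_3_eq_3)
  ultimately show ?thesis by blast
qed

text \<open>The cubic is the line times the conic. Each factor vanishes to order 2 along every arc
  tangent to \<open>l\<close>, and \<open>2 + 2 = 1 + 3\<close>.\<close>

lemma cond_b_imp_triple: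
  assumes gp: "general_position P" and Q: "valid_pt P Q" and b: "cond_b P Q"
  shows "\<exists>F. hom_form 3 F \<and> F \<noteq> (\<lambda>_. 0) \<and> (\<forall>i\<in>{1..6}. F (P i) = 0) \<and> div_mult_ge P 1 F Q 3"
proof -
  obtain i j G where ij: "i \<in> {1..6}" "j \<in> {1..6}" "i \<noteq> j"
    and G: "conic_eq P j G" "on_E i Q" "on_transform P (line_form P i j) Q"
    and tangent: "\<exists>q. \<forall>t. G (vadd (P i) (smul t (P j))) = t^2 * poly q t"
    using b unfolding cond_b_def by blast
  obtain l where l: "Q = Exc i l" using G(2) by (cases Q) auto
  have li: "normalized l" "dotp l (P i) = 0" using Q unfolding l by auto
  have G2: "hom_form 2 G" "G \<noteq> (\<lambda>_. 0)" "\<And>k. k \<in> {1..6} - {j} \<Longrightarrow> G (P k) = 0"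
    using G(1) unfolding conic_eq_def by auto
  let ?L = "det3 (P i) (P j)"
  let ?F = "\<lambda>v. ?L v * G v"
  obtain a b c d where "{a,b,c,d} \<subseteq> {1..6} - {i,j}" "distinct [a,b,c,d]"
    by (rule six_indices_minus[OF ij(1,2)])
  then have "?L (P a) \<noteq> 0" by (intro general_position_det[OF gp ij(1,2) _ ij(3)]) auto
  note L0 = det3_form_nonzero[OF this]
  have mult1: "mult_ge ?L (P i) 1" by (rule det3_form_mult_ge) simp
  have "div_mult_ge P 1 ?F (Exc i l) 3"
    unfolding div_mult_ge_lin3
  proof (intro allI impI)
    fix R W and a b :: complex
    assume RW: "dotp l R = 0 \<and> \<not> (\<exists>c. R = smul c (P i)) \<and> dotp l W \<noteq> 0" and a: "a \<noteq> 0"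
    have D: "det3 (P i) R W \<noteq> 0"
      using RW li by (intro kernel_basis[OF general_position_nonzero[OF gp ij(1)]]) auto
    \<comment> \<open>A linear form with order 2 on \<open>l\<close> vanishes on \<open>l\<close>,
      so \<open>P j\<close> lies on \<open>l\<close> and its coordinate \<open>w\<close> is
      0.\<close>
    have "\<exists>q. \<forall>t. ?L (vadd (P i) (smul t R)) = t ^ Suc 1 * poly q t"
      using G(3) RW mult1 unfolding l on_transform.simps line_form_def by blast
    then obtain q where q: "\<And>t. ?L (vadd (P i) (smul t R)) = t^2 * poly q t"
      by (auto simp: numeral_2_eq_2)
    obtain x y w where Pj: "P j = lin3 (P i) R W x y w" by (rule lin3_coords[OF D])
    have L: "?L (lin3 (P i) R W z r s) = (y * s - r * w) * det3 (P i) R W" for z r s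
      unfolding Pj by simp
    have "poly [:0, - w * det3 (P i) R W:] t = t^2 * poly q t" for t
      using q[of t] line_lin3[of "P i" t R W 0 1 0] by (simp add: L mult_ac)
    from poly_low_coeffs[OF this, of 1] have "w = 0" using D by simp
    note Pj = Pj[unfolded this] and L = L[unfolded this]
    have y: "y \<noteq> 0" using L0 lin3_coords[OF D] L by (metis diff_self mult_zero_left mult_zero_right)
    obtain c200 c110 c101 c020 c011 c002 where
      E: "\<And>z r w. G (lin3 (P i) R W z r w) = c200 * z^2 + c110 * z * r + c101 * z * w +
        c020 * r^2 + c011 * r * w + c002 * w^2"
      using quadric_expand[OF G2(1)] by blast
    obtain q' where q': "\<And>t. G (vadd (P i) (smul t (P j))) = t^2 * poly q' t"
      using tangent by blast
    \<comment> \<open>Tangency in the direction \<open>P j\<close> removes \<open>c200\<close> and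
      then, as \<open>y\<close> is nonzero, \<open>c110\<close>. Every monomial left in
      \<open>G\<close> has order at least 2 along the arcs.\<close>
    have "poly [:c200, 2 * c200 * x + c110 * y, c200 * x^2 + c110 * x * y + c020 * y^2:] t = t^2 * poly q' t" for t
      using q'[of t] unfolding Pj by (simp add: line_lin3 E algebra_simps power2_eq_square)
    note c = poly_low_coeffs[OF this]
    have c0: "c200 = 0" "c110 = 0" using c[of 0] c[of 1] y by auto
    show "\<exists>q. \<forall>s. ?F (lin3 (P i) R W 1 (s*a) (s*a*(s*b))) = s^(1+3) * poly q s"
      by (intro exI[of _ "smult (y * a * b * det3 (P i) R W) [:c101 * a * b + c020 * a^2, c011 * a^2 * b, c002 * a^2 * b^2:]"])
        (simp add: L E c0 algebra_simps eval_nat_numeral)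
  qed
  moreover have "hom_form 3 ?F" using hom_form_mult[OF hom_form_det3 G2(1), of "P i" "P j"] by (simp add: numeral_3_eq_3)
  moreover have "?F \<noteq> (\<lambda>_. 0)" by (rule hom_form_mult_nonzero[OF hom_form_det3 G2(1) L0 G2(2)])
  moreover have "?F (P k) = 0" if "k \<in> {1..6}" for k
    using G2(3)[of k] that by (cases "k = j") auto
  ultimately show ?thesis unfolding l by blast
qed

lemma triple_iff:
  assumes gp: "general_position P" and Z: "Z \<noteq> {}" "\<forall>Q\<in>Z. valid_pt P Q"
  shows "(\<exists>F. hom_form 3 F \<and> F \<noteq> (\<lambda>_. 0) \<and> (\<forall>i\<in>{1..6}. F (P i) = 0) \<and> (\<forall>Q\<in>Z. div_mult_ge P 1 F Q 3))
    \<longleftrightarrow> (\<exists>Q. Z = {Q} \<and> (cond_a P Q \<or> cond_b P Q))" (is "?L \<longleftrightarrow> ?R")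
proof
  assume ?R
  then obtain Q where Q: "Z = {Q}" "cond_a P Q \<or> cond_b P Q" by blast
  then have "valid_pt P Q" using Z by blast
  then show ?L using cond_a_imp_triple[OF gp] cond_b_imp_triple[OF gp] Q by blast
next
  assume ?L
  then obtain F where F: "hom_form 3 F" "F \<noteq> (\<lambda>_. 0)" "\<And>i. i \<in> {1..6} \<Longrightarrow> F (P i) = 0"
    and t: "\<And>Q. Q \<in> Z \<Longrightarrow> div_mult_ge P 1 F Q 3" by blast
  have uniq: "Q = Q'" if "Q \<in> Z" "Q' \<in> Z" for Q Q'
  proof -
    have v: "valid_pt P Q" "valid_pt P Q'" using that Z by auto
    note t = t[OF that(1)] t[OF that(2)]
    show ?thesis
    proof (cases Q)
      case Q: (Ord p)
      show ?thesis
      proof (cases Q')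
        case Q': (Ord p')
        show ?thesis using triple_points_ordinary_ordinary[OF gp _ _ F] v t unfolding Q Q' by simp
      next
        case Q': (Exc i l)
        show ?thesis using no_triple_points_ordinary_exceptional[OF gp _ _ F] v t unfolding Q Q'
          by (meson div_mult_ge.simps(1))
      qed
    next
      case Q: (Exc i l)
      show ?thesis
      proof (cases Q')
        case Q': (Ord p')
        show ?thesis using no_triple_points_ordinary_exceptional[OF gp _ _ F] v t unfolding Q Q'
          by (meson div_mult_ge.simps(1))
      next
        case Q': (Exc i' l')
        have mem: "i \<in> {1..6}" "i' \<in> {1..6}" using v unfolding Q Q' by auto
        have "i = i'"
          using exceptional_triple_double[OF gp v(1)[unfolded Q] F(1) t(1)[unfolded Q]]
            exceptional_triple_double[OF gp v(2)[unfolded Q'] F(1) t(2)[unfolded Q']]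
          by (intro double_points_unique[OF gp mem F(1,2)] F(3))
        moreover have "l = l'"
          using v t unfolding Q Q' \<open>i = i'\<close>[symmetric]
          by (intro triple_points_same_exceptional[OF gp _ _ F])
        ultimately show ?thesis unfolding Q Q' by simp
      qed
    qed
  qed
  obtain Q where Q: "Q \<in> Z" using Z by blast
  then have "Z = {Q}" using uniq by blast
  moreover have "cond_a P Q \<or> cond_b P Q"
  proof (cases Q)
    case (Ord p)
    have "cond_a P Q"
      using ordinary_triple_imp_cond_a[OF gp _ F] Q Z t[OF Q] unfolding Ord div_mult_ge.simps by blast
    then show ?thesis by blast
  next
    case (Exc i l)
    have "cond_b P Q"
      using Q Z t[OF Q] unfolding Exc by (intro exceptional_triple_imp_cond_b[OF gp _ F]) blast+
    then show ?thesis by blast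
  qed
  ultimately show ?R by blast
qed

subsection \<open>The initial degree\<close>

text \<open>Two line pairs through \<open>P a\<close>, \<open>P b\<close>, \<open>P c\<close>,
  \<open>P d\<close> span a pencil of conics; \<open>G\<close> is its member through the fifth point
  \<open>P e\<close>.\<close>

lemma conic_exists:
  assumes gp: "general_position P" and j: "j \<in> {1..6}"
  obtains G where "conic_eq P j G"
proof -
  obtain a b c d where abcd: "{a,b,c,d} \<subseteq> {1..6} - {j,j}" "distinct [a,b,c,d]"
    by (rule six_indices_minus[OF j j])
  have sub: "{j,a,b,c,d} \<subseteq> {1..6}" using abcd(1) j by blast
  have "j \<notin> {a,b,c,d}" using abcd(1) by blast
  then have "distinct [j,a,b,c,d]" using abcd(2) by simp
  from distinct_card[OF this] have "card {j,a,b,c,d} = 5" by simp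
  then have "card ({1..6} - {j,a,b,c,d}) = 1" using card_Diff_subset[OF _ sub] by simp
  then obtain e where e: "{1..6} - {j,a,b,c,d} = {e}" by (rule card_1_singletonE)
  then have em: "e \<in> {1..6} - {j,a,b,c,d}" by blast
  have mem: "a \<in> {1..6}" "b \<in> {1..6}" "c \<in> {1..6}" "d \<in> {1..6}" "e \<in> {1..6}"
    using sub em by blast+
  have ne: "e \<noteq> a" "e \<noteq> b" "e \<noteq> c" "e \<noteq> d" using em by blast+
  have ne': "a \<noteq> b" "a \<noteq> c" "a \<noteq> d" "b \<noteq> c" "b \<noteq> d" "c \<noteq> d" using abcd(2) by auto
  define q1 where "q1 v = det3 (P a) (P b) v * det3 (P c) (P d) v" for v
  define q2 where "q2 v = det3 (P a) (P c) v * det3 (P b) (P d) v" for v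
  define G where "G v = q2 (P e) * q1 v + (- q1 (P e)) * q2 v" for v
  have hom: "hom_form 2 q1" "hom_form 2 q2"
    unfolding q1_def q2_def one_add_one[symmetric] by (rule hom_form_mult[OF hom_form_det3 hom_form_det3])+
  have "hom_form 2 G"
    unfolding G_def using hom by (intro hom_form_add hom_form_cmult)
  moreover have "G \<noteq> (\<lambda>_. 0)"
  proof
    assume "G = (\<lambda>_. 0)"
    \<comment> \<open>The test point \<open>P a + P c\<close> lies on one line of \<open>q2\<close>
      and on neither line of \<open>q1\<close>.\<close>
    then have "G (lin3 (P a) (P b) (P c) 1 0 1) = 0" by simp
    moreover have "q2 (lin3 (P a) (P b) (P c) 1 0 1) = 0" unfolding q2_def by (simp add: det3_lin3_right)
    moreover have "q1 (lin3 (P a) (P b) (P c) 1 0 1) \<noteq> 0"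
      unfolding q1_def using general_position_det[OF gp mem(1,2,3)] general_position_det[OF gp mem(3,4,1)] ne'
      by (simp add: det3_lin3_right)
    moreover have "q2 (P e) \<noteq> 0"
      unfolding q2_def using general_position_det[OF gp mem(1,3,5)] general_position_det[OF gp mem(2,4,5)] ne ne'
      by simp
    ultimately show False unfolding G_def by simp
  qed
  moreover have "G (P k) = 0" if "k \<in> {1..6} - {j}" for k
  proof -
    have "k \<in> {a,b,c,d,e}" using e that by blast
    then show ?thesis unfolding G_def q1_def q2_def by auto
  qed
  ultimately have "conic_eq P j G" unfolding conic_eq_def by blast
  then show ?thesis by (rule that)
qed

text \<open>Unlike \<^const>\<open>section_dL\<close>, the vanishing at the \<open>P i\<close> is required along curved arcs, which makes
  the multiplicity bound 0 on the exceptional curves immediate.\<close>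

definition arc_section :: "(nat \<Rightarrow> vec3) \<Rightarrow> nat \<Rightarrow> (vec3 \<Rightarrow> complex) \<Rightarrow> bool" where
  "arc_section P d F \<longleftrightarrow> hom_form (3*d) F \<and> (\<forall>i\<in>{1..6}. \<forall>R W a b. \<exists>q :: complex poly. \<forall>s.
      F (vadd (P i) (vadd (smul (s*a) R) (smul (s*a*(s*b)) W))) = s^d * poly q s)"

lemma arc_section_imp_section:
  assumes "arc_section P d F"
  shows "section_dL P d F"
  unfolding section_dL_def
proof (intro conjI ballI)
  show "hom_form (3*d) F" using assms unfolding arc_section_def by blast
  fix i :: nat assume "i \<in> {1..6}"
  then have *: "\<exists>q. \<forall>s. F (vadd (P i) (vadd (smul (s*1) R) (smul (s*1*(s*0)) W))) = s^d * poly q s" for R W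
    using assms unfolding arc_section_def by blast
  show "mult_ge F (P i) d"
    unfolding mult_ge_def using *[of _ "(0,0,0)"] by simp
qed

lemma poly_power_mult_ex:
  fixes f g :: "complex \<Rightarrow> complex"
  assumes "\<exists>q. \<forall>s. f s = s^m * poly q s" "\<exists>q. \<forall>s. g s = s^n * poly q s"
  shows "\<exists>q. \<forall>s. f s * g s = s^(m+n) * poly q s"
proof -
  obtain q q' where "\<And>s. f s = s^m * poly q s" "\<And>s. g s = s^n * poly q' s" using assms by metis
  then have "\<forall>s. f s * g s = s^(m+n) * poly (q * q') s" by (simp add: power_add)
  then show ?thesis by blast
qed

lemma arc_section_mult:
  assumes "arc_section P d F" "arc_section P e G"
  shows "arc_section P (d + e) (\<lambda>v. F v * G v)"
  unfolding arc_section_def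
proof (intro conjI ballI allI)
  show "hom_form (3 * (d + e)) (\<lambda>v. F v * G v)"
    using assms hom_form_mult unfolding arc_section_def distrib_left by blast
qed (use assms in \<open>unfold arc_section_def, intro poly_power_mult_ex; blast\<close>)

lemma div_mult_ge_mult:
  assumes "div_mult_ge P d F Q m" "div_mult_ge P e G Q n"
  shows "div_mult_ge P (d + e) (\<lambda>v. F v * G v) Q (m + n)"
proof (cases Q)
  case (Ord p)
  then show ?thesis using assms mult_ge_mult by simp
next
  case (Exc i l)
  have e: "d + e + (m + n) = (d + m) + (e + n)" by simp
  show ?thesis using assms unfolding Exc div_mult_ge.simps e
    by (intro allI impI poly_power_mult_ex; blast)
qed

lemma arc_section_div_mult_ge_0:
  assumes "arc_section P d F" "valid_pt P Q"
  shows "div_mult_ge P d F Q 0"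
proof (cases Q)
  case (Ord p)
  have "hom_form (3*d) F" using assms unfolding arc_section_def by blast
  then show ?thesis
    unfolding Ord div_mult_ge.simps mult_ge_def power_0 mult_1_left using hom_form_along_line by metis
next
  case (Exc i l)
  then show ?thesis using assms unfolding arc_section_def by simp
qed

text \<open>The cubic is the conic through five of the six points times a line.\<close>

lemma arc_section_through_point:
  assumes gp: "general_position P" and Q: "valid_pt P Q"
  obtains F where "arc_section P 1 F" "F \<noteq> (\<lambda>_. 0)" "div_mult_ge P 1 F Q 1"
proof -
  have product: "arc_section P 1 (\<lambda>v. L v * G v)" "(\<lambda>v. L v * G v) \<noteq> (\<lambda>_. 0)"
    if "j \<in> {1..6}" "conic_eq P j G" "hom_form 1 L" "L \<noteq> (\<lambda>_. 0)" "L (P j) = 0" for j L G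
  proof -
    have G: "hom_form 2 G" "G \<noteq> (\<lambda>_. 0)" "\<And>k. k \<in> {1..6} - {j} \<Longrightarrow> G (P k) = 0"
      using that(2) unfolding conic_eq_def by auto
    have hom: "hom_form 3 (\<lambda>v. L v * G v)" using hom_form_mult[OF that(3) G(1)] by (simp add: numeral_3_eq_3)
    moreover have "L (P k) * G (P k) = 0" if "k \<in> {1..6}" for k
      using G(3)[of k] that \<open>L (P j) = 0\<close> by (cases "k = j") auto
    ultimately show "arc_section P 1 (\<lambda>v. L v * G v)"
      unfolding arc_section_def using arc_vanish[OF hom] by simp
    show "(\<lambda>v. L v * G v) \<noteq> (\<lambda>_. 0)" by (rule hom_form_mult_nonzero[OF that(3) G(1) that(4) G(2)])
  qed
  show ?thesis
  proof (cases Q)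
    case (Ord p)
    \<comment> \<open>The line joins \<open>P 6\<close>, the point missed by the conic, to
      \<open>p\<close>.\<close>
    obtain G where G: "conic_eq P 6 G" by (rule conic_exists[OF gp, of 6]) simp
    have "\<not> (\<exists>c. p = smul c (P 6))" using Q Ord by auto
    then have L0: "det3 (P 6) p \<noteq> (\<lambda>_. 0)"
      using proportional_if_dependent[OF general_position_nonzero[OF gp, of 6], of p] by (auto simp: fun_eq_iff)
    have sec: "arc_section P 1 (\<lambda>v. det3 (P 6) p v * G v)" "(\<lambda>v. det3 (P 6) p v * G v) \<noteq> (\<lambda>_. 0)"
      by (rule product[OF _ G hom_form_det3 L0]; simp)+
    moreover have "div_mult_ge P 1 (\<lambda>v. det3 (P 6) p v * G v) Q 1"
    proof -
      have "hom_form (3 * 1) (\<lambda>v. det3 (P 6) p v * G v)" using sec(1) unfolding arc_section_def by blast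
      from mult_ge_1[OF this, of p] show ?thesis unfolding Ord by simp
    qed
    ultimately show ?thesis by (rule that)
  next
    case (Exc i l)
    have i: "i \<in> {1..6}" using Q Exc by auto
    obtain j b c d where jb: "{j,b,c,d} \<subseteq> {1..6} - {i,i}" "distinct [j,b,c,d]"
      by (rule six_indices_minus[OF i i])
    then have j: "j \<in> {1..6}" "i \<noteq> j" "b \<in> {1..6}" "i \<noteq> b" "j \<noteq> b" by auto
    \<comment> \<open>The line through \<open>P i\<close> and \<open>P j\<close> supplies the point
      missed by \<open>G\<close>. Both factors vanish at \<open>P i\<close>, which gives order
      \<open>1 + 1\<close> along every arc, whatever the direction \<open>l\<close>.\<close>
    obtain G where G: "conic_eq P j G" by (rule conic_exists[OF gp j(1)])
    have L0: "det3 (P i) (P j) \<noteq> (\<lambda>_. 0)"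
      by (rule det3_form_nonzero[OF general_position_det[OF gp i j(1,3,2,4,5)]])
    have sec: "arc_section P 1 (\<lambda>v. det3 (P i) (P j) v * G v)" "(\<lambda>v. det3 (P i) (P j) v * G v) \<noteq> (\<lambda>_. 0)"
      by (rule product[OF j(1) G hom_form_det3 L0]; simp)+
    have G2: "hom_form 2 G" "G (P i) = 0" using G i j unfolding conic_eq_def by auto
    have "div_mult_ge P 1 (\<lambda>v. det3 (P i) (P j) v * G v) Q 1"
      unfolding Exc div_mult_ge.simps
    proof (intro allI impI poly_power_mult_ex)
      fix R W and a b :: complex
      show "\<exists>q. \<forall>s. det3 (P i) (P j) (vadd (P i) (vadd (smul (s*a) R) (smul (s*a*(s*b)) W))) = s^1 * poly q s"
        unfolding power_one_right by (rule arc_vanish[OF hom_form_det3]) simp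
      show "\<exists>q. \<forall>s. G (vadd (P i) (vadd (smul (s*a) R) (smul (s*a*(s*b)) W))) = s^1 * poly q s"
        unfolding power_one_right by (rule arc_vanish[OF G2])
    qed
    with sec show ?thesis by (rule that)
  qed
qed

text \<open>Multiplying the cubes of sections through the single points of \<open>Z\<close> gives a
  section triple on all of \<open>Z\<close>. This shows that the \<open>LEAST\<close> in
  \<open>alpha\<close> is attained.\<close>

lemma arc_section_triple_exists:
  assumes gp: "general_position P" and "finite Z" "\<forall>Q\<in>Z. valid_pt P Q"
  shows "\<exists>d F. arc_section P d F \<and> F \<noteq> (\<lambda>_. 0) \<and> (\<forall>Q\<in>Z. div_mult_ge P d F Q 3)"
  using assms(2,3)
proof (induction Z rule: finite_induct)
  case empty
  have "arc_section P 0 (\<lambda>_. 1)" "(\<lambda>_::vec3. 1::complex) \<noteq> (\<lambda>_. 0)"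
    unfolding arc_section_def using hom_form_1 by (auto simp: fun_eq_iff intro!: exI[of _ 1])
  then show ?case by blast
next
  case (insert Q Z)
  obtain d F where F: "arc_section P d F" "F \<noteq> (\<lambda>_. 0)" "\<And>Q. Q \<in> Z \<Longrightarrow> div_mult_ge P d F Q 3"
    using insert by auto
  obtain G where G: "arc_section P 1 G" "G \<noteq> (\<lambda>_. 0)" "div_mult_ge P 1 G Q 1"
    using arc_section_through_point[OF gp] insert.prems by blast
  define K where "K v = G v * (G v * G v)" for v
  \<comment> \<open>Degree and multiplicity stay written as \<open>1 + (1 + 1)\<close> so that the
    product rules match literally.\<close>
  have K: "arc_section P (1 + (1 + 1)) K" "div_mult_ge P (1 + (1 + 1)) K Q (1 + (1 + 1))"
    unfolding K_def by (intro arc_section_mult div_mult_ge_mult G)+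
  have K0: "K \<noteq> (\<lambda>_. 0)" using G(2) unfolding K_def by (auto simp: fun_eq_iff)
  let ?F = "\<lambda>v. F v * K v"
  have "arc_section P (d + (1 + (1 + 1))) ?F" by (rule arc_section_mult[OF F(1) K(1)])
  moreover have "?F \<noteq> (\<lambda>_. 0)"
    using F(1) K(1) unfolding arc_section_def by (intro hom_form_mult_nonzero[OF _ _ F(2) K0]) blast+
  moreover have "div_mult_ge P (d + (1 + (1 + 1))) ?F Q' 3" if "Q' \<in> insert Q Z" for Q'
  proof (cases "Q' = Q")
    case True
    have "div_mult_ge P d F Q 0" by (rule arc_section_div_mult_ge_0[OF F(1)]) (use insert.prems in blast)
    from div_mult_ge_mult[OF this K(2)] show ?thesis unfolding True by (simp add: numeral_3_eq_3)
  next
    case False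
    then have Q': "Q' \<in> Z" using that by blast
    have "div_mult_ge P (1 + (1 + 1)) K Q' 0"
      by (rule arc_section_div_mult_ge_0[OF K(1)]) (use insert.prems Q' in blast)
    from div_mult_ge_mult[OF F(3)[OF Q'] this] show ?thesis by simp
  qed
  ultimately show ?case by blast
qed

lemma div_mult_ge_mono:
  assumes "div_mult_ge P d F Q m" "n \<le> m"
  shows "div_mult_ge P d F Q n"
proof (cases Q)
  case (Ord p)
  then show ?thesis using assms mult_ge_mono by simp
next
  case (Exc i l)
  have *: "\<exists>q. \<forall>s. f s = s^(d+n) * poly q s" if q: "\<exists>q. \<forall>s. f s = s^(d+m) * poly q s"
    for f :: "complex \<Rightarrow> complex"
  proof -
    obtain q where "\<And>s. f s = s^(d+m) * poly q s" using q by blast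
    then have "\<forall>s. f s = s^(d+n) * poly (monom 1 (m-n) * q) s"
      using assms(2) by (simp add: poly_monom flip: power_add mult.assoc)
    then show ?thesis by blast
  qed
  show ?thesis using assms(1) unfolding Exc div_mult_ge.simps by (intro allI impI *) blast
qed

text \<open>A form of degree 0 is constant, and the order condition at parameter 0 would make a
  positive \<open>m\<close> force this constant to vanish.\<close>

lemma degree_0_section_no_vanishing:
  assumes gp: "general_position P" and Q: "valid_pt P Q"
    and F: "section_dL P 0 F" "F \<noteq> (\<lambda>_. 0)" "div_mult_ge P 0 F Q m"
  shows "m = 0"
proof (rule ccontr)
  assume m: "m \<noteq> 0"
  have "hom_form 0 F" using F(1) unfolding section_dL_def by simp
  then obtain c where c: "\<And>x y z. F (x,y,z) = (\<Sum>a\<le>0. \<Sum>b\<le>0-a. c a b * x^a * y^b * z^(0-a-b))"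
    unfolding hom_form_def by blast
  have const: "F v = c 0 0" for v by (cases v) (simp add: c)
  have "c 0 0 = 0"
  proof (cases Q)
    case (Ord p)
    then show ?thesis using mult_ge_vanish[of F p m] F(3) m const by simp
  next
    case (Exc i l)
    obtain R W where "dotp l R = 0" "\<not> (\<exists>c. R = smul c (P i))" "dotp l W \<noteq> 0"
      using exceptional_basis[OF gp Q[unfolded Exc]] by blast
    then have "\<exists>q. \<forall>s. F (lin3 (P i) R W 1 (s*1) (s*1*(s*1))) = s^(0+m) * poly q s"
      using F(3) unfolding Exc div_mult_ge_lin3 by (metis one_neq_zero)
    then obtain q where "\<And>s. c 0 0 = s^m * poly q s" unfolding const by auto
    from this[of 0] show ?thesis using m by simp
  qed
  then show False using F(2) const by auto
qed

text \<open>Degree 0 is impossible for positive \<open>m\<close>, and some degree is possible, so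
  the least one is 1 exactly when degree 1 is possible.\<close>

lemma alpha_eq_1_iff:
  assumes gp: "general_position P" and Z: "finite Z" "Z \<noteq> {}" "\<forall>Q\<in>Z. valid_pt P Q"
    and m: "1 \<le> m" "m \<le> 3"
  shows "alpha P Z m = 1 \<longleftrightarrow> (\<exists>F. section_dL P 1 F \<and> F \<noteq> (\<lambda>_. 0) \<and> (\<forall>Q\<in>Z. div_mult_ge P 1 F Q m))"
proof -
  define A where "A d \<longleftrightarrow> (\<exists>F. section_dL P d F \<and> F \<noteq> (\<lambda>_. 0) \<and> (\<forall>Q\<in>Z. div_mult_ge P d F Q m))" for d
  have alpha: "alpha P Z m = (LEAST d. A d)" unfolding alpha_def A_def ..
  obtain d F where "arc_section P d F" "F \<noteq> (\<lambda>_. 0)" "\<forall>Q\<in>Z. div_mult_ge P d F Q 3"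
    using arc_section_triple_exists[OF gp Z(1,3)] by blast
  then have "A d" unfolding A_def using arc_section_imp_section div_mult_ge_mono[OF _ m(2)] by blast
  then have least: "A (LEAST d. A d)" by (rule LeastI)
  have "\<not> A 0"
  proof
    assume "A 0"
    moreover obtain Q where "Q \<in> Z" using Z by blast
    ultimately have "m = 0" unfolding A_def using degree_0_section_no_vanishing[OF gp] Z by blast
    then show False using m by simp
  qed
  then have "A 1 \<Longrightarrow> (LEAST d. A d) = 1"
    using least by (intro Least_equality) (auto simp: Suc_le_eq intro!: gr0I)
  then have "alpha P Z m = 1 \<longleftrightarrow> A 1" using least unfolding alpha by metis
  then show ?thesis unfolding A_def .
qed

theorem theorem11:
  fixes P :: "nat \<Rightarrow> vec3" and Z :: "spt set"
  assumes "general_position P"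
    and "finite Z" and "Z \<noteq> {}" and "\<forall>Q\<in>Z. valid_pt P Q"
  shows "(alpha P Z 1 = 1 \<and> alpha P Z 2 = 1 \<and> alpha P Z 3 = 1) \<longleftrightarrow>
         (\<exists>Q. Z = {Q} \<and> (cond_a P Q \<or> cond_b P Q))"
proof -
  let ?A = "\<lambda>m. \<exists>F. section_dL P 1 F \<and> F \<noteq> (\<lambda>_. 0) \<and> (\<forall>Q\<in>Z. div_mult_ge P 1 F Q m)"
  have mono: "?A m" if "?A 3" "m \<le> 3" for m
    using that div_mult_ge_mono by blast
  have "alpha P Z m = 1 \<longleftrightarrow> ?A m" if "1 \<le> m" "m \<le> 3" for m
    by (rule alpha_eq_1_iff[OF assms that])
  then have "(alpha P Z 1 = 1 \<and> alpha P Z 2 = 1 \<and> alpha P Z 3 = 1) \<longleftrightarrow> ?A 1 \<and> ?A 2 \<and> ?A 3"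
    by simp
  \<comment> \<open>A cubic with multiplicity 3 on \<open>Z\<close> also witnesses multiplicities 1
    and 2.\<close>
  also have "\<dots> \<longleftrightarrow> ?A 3" using mono[of 1] mono[of 2] by auto
  also have "\<dots> \<longleftrightarrow> (\<exists>F. hom_form 3 F \<and> F \<noteq> (\<lambda>_. 0) \<and> (\<forall>i\<in>{1..6}. F (P i) = 0) \<and>
      (\<forall>Q\<in>Z. div_mult_ge P 1 F Q 3))"
  proof -
    have "mult_ge F p 1 \<longleftrightarrow> F p = 0" if "hom_form 3 F" for F p
      using mult_ge_1[OF that] mult_ge_vanish[of F p 1] by blast
    then have "section_dL P 1 F \<longleftrightarrow> hom_form 3 F \<and> (\<forall>i\<in>{1..6}. F (P i) = 0)" for F
      unfolding section_dL_def mult_1_right by blast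
    then show ?thesis by blast
  qed
  also have "\<dots> \<longleftrightarrow> (\<exists>Q. Z = {Q} \<and> (cond_a P Q \<or> cond_b P Q))"
    by (rule triple_iff[OF assms(1,3,4)])
  finally show ?thesis .
qed

end
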